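(* Let $\theta>0$ and $\bar\gamma=(2\theta\sigma_R^2)^{-1/2}$. (i) For any $0<\gamma<\bar\gamma$ there exists $N(\gamma)>0$ such that for all $n>N(\gamma)$, $$P_n^{\theta/n}\big(L_{[n\gamma t]}((\sqrt n\,t,\infty))=0\ \text{for all } t \text{ large enough}\big)=1.$$ (ii) For any $\gamma>\bar\gamma$ there exists $N(\gamma)>0$ such that for all $n>N(\gamma)$, $$P_n^{\theta/n}\big(X_{[n\gamma t]}((\sqrt n\,t,\infty))>0\ \text{for all } t\text{ large enough}\,\big|\,X\text{ survives}\big)=1.$$
   Context: Branching random walk. Fix a jump distribution $\{a_k\}_{k\in\mathbb{Z}}$ on $\mathbb{Z}$ supported in $[-R,R]$ for some $R<\infty$, with mean $0$ and variance $\sigma_R^2>0$. For each $\eta>-1$ fix an offspring distribution $F_B^\eta=\{p_i^\eta\}_{i\ge0}$ with $p_0^\eta>0$, mean $1+\eta$, variance $\sigma^2(\eta)$ and third moment $\gamma(\eta)$; assume that for some $\delta>0$, $\lim_{\eta\downarrow0}\sigma(\eta)=\sigma>0$ and $\sup_{\eta\in(0,\delta)}\gamma(\eta)<\infty$. $P_n^\eta$ is the law of the discrete-time branching random walk $X=(X_k(x))_{k\ge0,x\in\mathbb{Z}}$ started at generation $0$ by $n$ particles at the origin: in each generation every particle first jumps, independently, according to $\{a_k\}$, and is then replaced at its new site, independently, by a random number of offspring with law $F_B^\eta$; $X_k(x)$ is the number of particles at site $x$ at generation $k$. Let $L_m(x)=\sum_{k\le m}X_k(x)$, and for $A\subseteq\mathbb{R}$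 write $X_m(A)=\sum_{x\in A\cap\mathbb{Z}}X_m(x)$ and $L_m(A)=\sum_{x\in A\cap\mathbb{Z}}L_m(x)$. $[s]$ is the integer part of $s$, and $t$ ranges over positive reals. "$X$ survives" is the event that there is at least one particle at every generation. *)

theory Defs
  imports "HOL-Probability.Probability"
begin

text \<open>
  The branching random walk is built from one independent pair (jump, number of offspring)
  for every (generation, index of a particle within its generation). A generation is the list of
  the positions of its particles; the ordering only serves to tell the particles apart.
\<close>

primrec particles :: "nat \<Rightarrow> (nat \<times> nat \<Rightarrow> int \<times> nat) \<Rightarrow> nat \<Rightarrow> int list" where
  "particles n \<omega> 0 = replicate n 0"
| "particles n \<omega> (Suc k) =
     concat (map (\<lambda>i. replicate (snd (\<omega> (k, i))) (particles n \<omega> k ! i + fst (\<omega> (k, i))))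
       [0..<length (particles n \<omega> k)])"

definition particle_counts :: "nat \<Rightarrow> (nat \<times> nat \<Rightarrow> int \<times> nat) \<Rightarrow> nat \<Rightarrow> int \<Rightarrow> nat" where
  "particle_counts n \<omega> k x = count_list (particles n \<omega> k) x"

definition reproduction_space :: "int pmf \<Rightarrow> nat pmf \<Rightarrow> (nat \<times> nat \<Rightarrow> int \<times> nat) measure" where
  "reproduction_space a p = (\<Pi>\<^sub>M i\<in>UNIV. measure_pmf (pair_pmf a p))"

definition path_space :: "(nat \<Rightarrow> int \<Rightarrow> nat) measure" where
  "path_space = (\<Pi>\<^sub>M k\<in>UNIV. \<Pi>\<^sub>M x\<in>UNIV. count_space UNIV)"

definition brw_law :: "int pmf \<Rightarrow> nat pmf \<Rightarrow> nat \<Rightarrow> (nat \<Rightarrow> int \<Rightarrow> nat) measure" where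
  "brw_law a p n = distr (reproduction_space a p) path_space (particle_counts n)"

definition occupation :: "(nat \<Rightarrow> int \<Rightarrow> nat) \<Rightarrow> nat \<Rightarrow> int \<Rightarrow> nat" where
  "occupation X m x = (\<Sum>k\<le>m. X k x)"

text \<open>
  Values are in \<^typ>\<open>enat\<close> so that the sum over the integers in \<open>A\<close> is meaningful for every path.
\<close>

definition total_on_set :: "(int \<Rightarrow> nat) \<Rightarrow> real set \<Rightarrow> enat" where
  "total_on_set f A = (\<Sum>\<^sub>\<infinity>x\<in>{x. real_of_int x \<in> A}. enat (f x))"

definition survives :: "(nat \<Rightarrow> int \<Rightarrow> nat) \<Rightarrow> bool" where
  "survives X \<longleftrightarrow> (\<forall>k. \<exists>x. X k x > 0)"

text \<open>
  The map in \<^const>\<open>brw_law\<close> is measurable, hence \<^const>\<open>brw_law\<close> is a probability measure.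
\<close>

lemma measurable_reproduction [measurable]:
  "(\<lambda>\<omega>. \<omega> j) \<in> measurable (reproduction_space a p) (count_space UNIV)"
proof -
  have "(\<lambda>\<omega>. \<omega> j) \<in> measurable (reproduction_space a p) (measure_pmf (pair_pmf a p))"
    unfolding reproduction_space_def by (rule measurable_component_singleton) simp
  then show ?thesis by simp
qed

lemma measurable_offspring:
  "(\<lambda>\<omega>. concat (map (\<lambda>i. replicate (snd (\<omega> (k, i))) (xs ! i + fst (\<omega> (k, i)))) is))
     \<in> measurable (reproduction_space a p) (count_space UNIV)"
proof (induction "is")
  case (Cons i "is")
  have 1: "(\<lambda>\<omega>. replicate (snd (\<omega> (k, i))) (xs ! i + fst (\<omega> (k, i))))
      \<in> measurable (reproduction_space a p) (count_space UNIV)"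
    by (rule measurable_compose[OF measurable_reproduction]) simp
  have "(\<lambda>\<omega>. (\<lambda>u \<omega>. u @ concat (map (\<lambda>i. replicate (snd (\<omega> (k, i))) (xs ! i + fst (\<omega> (k, i)))) is))
      (replicate (snd (\<omega> (k, i))) (xs ! i + fst (\<omega> (k, i)))) \<omega>)
      \<in> measurable (reproduction_space a p) (count_space UNIV)"
    by (rule measurable_compose_countable[OF _ 1], rule measurable_compose[OF Cons.IH]) simp
  then show ?case by simp
qed simp

lemma measurable_particles:
  "(\<lambda>\<omega>. particles n \<omega> k) \<in> measurable (reproduction_space a p) (count_space UNIV)"
proof (induction k)
  case (Suc k)
  show ?case
    unfolding particles.simps
    by (rule measurable_compose_countable[OF measurable_offspring Suc.IH])
qed simp

lemma measurable_particle_counts: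
  "particle_counts n \<in> measurable (reproduction_space a p) path_space"
proof -
  have "(\<lambda>\<omega> k x. count_list (particles n \<omega> k) x) \<in> measurable (reproduction_space a p) path_space"
    unfolding path_space_def
    by (intro measurable_PiM_single' measurable_compose[OF measurable_particles])
      (auto simp: space_PiM)
  then show ?thesis
    by (simp add: particle_counts_def[abs_def])
qed

lemma prob_space_brw_law: "prob_space (brw_law a p n)"
proof -
  have "prob_space (reproduction_space a p)"
    unfolding reproduction_space_def by (intro prob_space_PiM measure_pmf.prob_space_axioms)
  then show ?thesis
    unfolding brw_law_def by (rule prob_space.prob_space_distr) (rule measurable_particle_counts)
qed

lemma total_on_set_eq_0_iff:
  "total_on_set f A = 0 \<longleftrightarrow> (\<forall>x. real_of_int x \<in> A \<longrightarrow> f x = 0)"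
proof
  assume 0: "total_on_set f A = 0"
  show "\<forall>x. real_of_int x \<in> A \<longrightarrow> f x = 0"
  proof (intro allI impI)
    fix x :: int assume "real_of_int x \<in> A"
    then have "(\<Sum>\<^sub>\<infinity>y\<in>{x}. enat (f y)) \<le> total_on_set f A"
      unfolding total_on_set_def
      by (intro infsum_mono_neutral nonneg_summable_on_complete) auto
    then show "f x = 0" using 0 by (simp add: zero_enat_def)
  qed
next
  assume "\<forall>x. real_of_int x \<in> A \<longrightarrow> f x = 0"
  then show "total_on_set f A = 0"
    unfolding total_on_set_def by (intro infsum_0) (auto simp: zero_enat_def)
qed

end

theory Submission
  imports Defs "HOL-Real_Asymp.Real_Asymp"
begin

text \<open>
  (i) The expected value of the sum of \<open>exp (l * x)\<close> over the particles of generation \<open>k\<close> is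
  \<open>n * (m * \<phi> l) ^ k\<close>, where \<open>m = 1 + \<theta> / n\<close> and \<open>\<phi>\<close> is the moment generating function of
  the jumps. For \<open>l = c / sqrt n\<close> with a suitable \<open>c\<close>, Markov's inequality and the Borel-Cantelli lemma keep
  all particles of generation \<open>k\<close> below \<open>k / (\<gamma> * sqrt n)\<close> for large \<open>k\<close>.

  (ii) By the central limit theorem, for a suitable block length \<open>L = n * T\<close> the expected number of descendants
  that are displaced by at least \<open>V\<close> (slightly more than \<open>L / (\<gamma> * sqrt n)\<close>) after \<open>L\<close> generations exceeds 1.
  Hence, from a single particle, the front advances by \<open>V\<close> in every block with probability at least
  \<open>1 - s\<close> for some \<open>s < 1\<close>. Restarting this at generation \<open>j\<close> from each of the particles that are alive, the front
  fails to advance with probability at most \<open>f\<^sub>j(s)\<^sup>n\<close>, while extinction by generation \<open>j\<close> has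
  probability \<open>f\<^sub>j(0)\<^sup>n\<close>, where \<open>f\<^sub>j\<close> is the \<open>j\<close>-th iterate of the offspring generating function.
  The difference tends to 0 because all iterates from \<open>[0, 1)\<close> converge to the same fixed point.
\<close>

section \<open>The chain of generations\<close>

text \<open>The law of the next generation given the current one. Drawing one (jump, offspring
  number) pair per list entry, in list order, matches the indexing of \<open>particles\<close> and
  makes the branching property a statement about appended lists.\<close>

primrec brw_step :: "int pmf \<Rightarrow> nat pmf \<Rightarrow> int list \<Rightarrow> int list pmf" where
  "brw_step a p [] = return_pmf []"
| "brw_step a p (x # xs) =
     bind_pmf (pair_pmf a p) (\<lambda>jb. map_pmf (\<lambda>ys. replicate (snd jb) (x + fst jb) @ ys) (brw_step a p xs))"

primrec brw_iter :: "int pmf \<Rightarrow> nat pmf \<Rightarrow> nat \<Rightarrow> int list \<Rightarrow> int list pmf" where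
  "brw_iter a p 0 xs = return_pmf xs"
| "brw_iter a p (Suc k) xs = bind_pmf (brw_step a p xs) (brw_iter a p k)"

text \<open>Joint law of the generations 0 to \<open>k\<close>, oldest first. The marginals in
  \<open>brw_iter\<close> do not suffice for events that look at several generations at once, such
  as a front that fails in some block.\<close>

primrec brw_path :: "int pmf \<Rightarrow> nat pmf \<Rightarrow> nat \<Rightarrow> int list \<Rightarrow> int list list pmf" where
  "brw_path a p 0 xs = return_pmf [xs]"
| "brw_path a p (Suc k) xs = bind_pmf (brw_step a p xs) (\<lambda>ys. map_pmf ((#) xs) (brw_path a p k ys))"

lemma set_brw_step:
  assumes "ys \<in> set_pmf (brw_step a p xs)" "y \<in> set ys"
  shows "\<exists>x\<in>set xs. \<exists>j\<in>set_pmf a. y = x + j"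
  using assms by (induction xs arbitrary: ys) fastforce+

lemma set_brw_iter_lower:
  assumes "\<And>j. j \<in> set_pmf a \<Longrightarrow> \<bar>j\<bar> \<le> r"
  shows "ys \<in> set_pmf (brw_iter a p k xs) \<Longrightarrow> \<forall>x\<in>set xs. l \<le> x \<Longrightarrow> y \<in> set ys \<Longrightarrow> l - r * int k \<le> y"
proof (induction k arbitrary: xs l)
  case (Suc k)
  from Suc.prems obtain zs where zs: "zs \<in> set_pmf (brw_step a p xs)" "ys \<in> set_pmf (brw_iter a p k zs)"
    by auto
  have "\<forall>z\<in>set zs. l - r \<le> z"
  proof
    fix z assume "z \<in> set zs"
    then obtain x j where "x \<in> set xs" "j \<in> set_pmf a" "z = x + j"
      using set_brw_step[OF zs(1)] by blast
    then show "l - r \<le> z" using Suc.prems(2) assms[of j] by fastforce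
  qed
  from Suc.IH[OF zs(2) this Suc.prems(3)] show ?case by (simp add: algebra_simps)
qed auto

lemma set_brw_path:
  "h \<in> set_pmf (brw_path a p k xs) \<Longrightarrow>
     length h = Suc k \<and> hd h = xs \<and> (\<forall>i<k. h ! Suc i \<in> set_pmf (brw_step a p (h ! i)))"
proof (induction k arbitrary: xs h)
  case (Suc k)
  then obtain ys g where g: "ys \<in> set_pmf (brw_step a p xs)" "g \<in> set_pmf (brw_path a p k ys)" "h = xs # g"
    by auto
  note IH = Suc.IH[OF g(2)]
  then have "g ! 0 = ys" by (cases g) auto
  with IH g show ?case by (auto simp: nth_Cons split: nat.splits)
qed auto

lemma map_last_brw_path: "map_pmf last (brw_path a p k xs) = brw_iter a p k xs"
proof (induction k arbitrary: xs)
  case (Suc k)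
  have "map_pmf last (map_pmf ((#) xs) (brw_path a p k ys)) = map_pmf last (brw_path a p k ys)" for ys
    unfolding pmf.map_comp using set_brw_path[of _ a p k ys] by (intro map_pmf_cong) fastforce+
  then show ?case by (simp add: map_bind_pmf Suc.IH)
qed (simp)

text \<open>The recursion of \<open>brw_path\<close> peels off the first generation, while the
  process on \<open>reproduction_space\<close> grows by its last one; this form, the Markov property
  at time \<open>k\<close>, is what \<open>distr_history\<close> needs.\<close>

lemma brw_path_snoc:
  "brw_path a p (Suc k) xs =
     bind_pmf (brw_path a p k xs) (\<lambda>h. map_pmf (\<lambda>y. h @ [y]) (brw_step a p (last h)))"
proof (induction k arbitrary: xs)
  case 0
  show ?case by (simp add: bind_return_pmf map_pmf_def)
next
  case (Suc k)
  have "brw_path a p (Suc (Suc k)) xs = bind_pmf (brw_step a p xs) (\<lambda>ys. map_pmf ((#) xs)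
     (bind_pmf (brw_path a p k ys) (\<lambda>h. map_pmf (\<lambda>y. h @ [y]) (brw_step a p (last h)))))"
    using Suc.IH by simp
  also have "\<dots> = bind_pmf (brw_step a p xs) (\<lambda>ys. bind_pmf (brw_path a p k ys)
      (\<lambda>h. map_pmf (\<lambda>y. (xs # h) @ [y]) (brw_step a p (last (xs # h)))))"
    using set_brw_path[of _ a p k]
    by (intro bind_pmf_cong refl) (fastforce simp: map_bind_pmf pmf.map_comp o_def intro!: bind_pmf_cong)
  also have "\<dots> = bind_pmf (brw_path a p (Suc k) xs) (\<lambda>h. map_pmf (\<lambda>y. h @ [y]) (brw_step a p (last h)))"
    by (simp add: bind_assoc_pmf bind_map_pmf)
  finally show ?case .
qed

text \<open>Branching property: two groups of particles reproduce independently.\<close>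

lemma brw_step_append:
  "brw_step a p (xs @ ys) = bind_pmf (brw_step a p xs) (\<lambda>u. map_pmf (\<lambda>v. u @ v) (brw_step a p ys))"
proof (induction xs)
  case Nil
  have "(@) [] = (\<lambda>v :: int list. v)" by auto
  then show ?case by (simp add: bind_return_pmf)
next
  case (Cons x xs)
  have "(@) (us @ vs) = (\<lambda>ws. us @ vs @ ws)" for us vs :: "int list" by auto
  then show ?case
    by (simp add: Cons.IH bind_assoc_pmf bind_map_pmf map_bind_pmf pmf.map_comp o_def)
qed

lemma brw_step_translate: "brw_step a p (map ((+) c) xs) = map_pmf (map ((+) c)) (brw_step a p xs)"
  by (induction xs) (simp_all add: map_bind_pmf pmf.map_comp o_def add.assoc)

lemma brw_iter_translate: "brw_iter a p k (map ((+) c) xs) = map_pmf (map ((+) c)) (brw_iter a p k xs)"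
  by (induction k arbitrary: xs) (simp_all add: brw_step_translate map_bind_pmf bind_map_pmf)

section \<open>Expected sums over a generation and generating functions of its size\<close>

lemma nn_integral_brw_step_sum_list:
  "(\<integral>\<^sup>+ys. sum_list (map h ys) \<partial>brw_step a p xs) =
     sum_list (map (\<lambda>x. (\<integral>\<^sup>+b. of_nat b \<partial>p) * (\<integral>\<^sup>+j. h (x + j) \<partial>a)) xs)" for h :: "int \<Rightarrow> ennreal"
proof (induction xs)
  case (Cons x xs)
  have "(\<integral>\<^sup>+ys. sum_list (map h ys) \<partial>brw_step a p (x # xs)) =
    (\<integral>\<^sup>+jb. of_nat (snd jb) * h (x + fst jb) + sum_list (map (\<lambda>x. (\<integral>\<^sup>+b. of_nat b \<partial>p) * (\<integral>\<^sup>+j. h (x + j) \<partial>a)) xs)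
       \<partial>pair_pmf a p)"
    by (simp add: sum_list_replicate nn_integral_add Cons.IH)
  also have "\<dots> = (\<integral>\<^sup>+jb. of_nat (snd jb) * h (x + fst jb) \<partial>pair_pmf a p) + sum_list (map (\<lambda>x. (\<integral>\<^sup>+b. of_nat b \<partial>p) * (\<integral>\<^sup>+j. h (x + j) \<partial>a)) xs)"
    by (subst nn_integral_add) auto
  also have "(\<integral>\<^sup>+jb. of_nat (snd jb) * h (x + fst jb) \<partial>pair_pmf a p) = (\<integral>\<^sup>+b. of_nat b \<partial>p) * (\<integral>\<^sup>+j. h (x + j) \<partial>a)"
    by (simp add: nn_integral_pair_pmf' nn_integral_cmult nn_integral_multc)
  finally show ?case by simp
qed simp

lemma nn_integral_brw_step_power:
  "(\<integral>\<^sup>+ys. s ^ length ys \<partial>brw_step a p xs) = (\<integral>\<^sup>+b. s ^ b \<partial>p) ^ length xs" for s :: ennreal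
proof (induction xs)
  case (Cons x xs)
  have "(\<integral>\<^sup>+ys. s ^ length ys \<partial>brw_step a p (x # xs)) = (\<integral>\<^sup>+jb. s ^ snd jb * (\<integral>\<^sup>+b. s ^ b \<partial>p) ^ length xs \<partial>pair_pmf a p)"
    by (simp add: power_add nn_integral_cmult Cons.IH)
  also have "\<dots> = (\<integral>\<^sup>+b. s ^ b \<partial>p) ^ length (x # xs)"
    by (simp add: nn_integral_pair_pmf' nn_integral_multc)
  finally show ?case .
qed simp

text \<open>Many-to-one principle: expectations of additive functionals are iterates of a linear
  mean operator. Together with \<open>funpow_walk_pmf\<close> this reduces them to a single random
  walk.\<close>

lemma nn_integral_brw_iter_sum_list:
  "(\<integral>\<^sup>+ys. sum_list (map h ys) \<partial>brw_iter a p k xs) =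
     sum_list (map (((\<lambda>h x. (\<integral>\<^sup>+b. of_nat b \<partial>p) * (\<integral>\<^sup>+j. h (x + j) \<partial>a)) ^^ k) h) xs)" for h :: "int \<Rightarrow> ennreal"
  by (induction k arbitrary: xs) (simp_all add: nn_integral_brw_step_sum_list)

lemma nn_integral_brw_iter_power:
  "(\<integral>\<^sup>+ys. s ^ length ys \<partial>brw_iter a p k xs) = ((\<lambda>s. \<integral>\<^sup>+b. s ^ b \<partial>p) ^^ k) s ^ length xs" for s :: ennreal
  by (induction k arbitrary: xs) (simp_all add: nn_integral_brw_step_power)

section \<open>Probability that some generation up to a horizon meets a condition\<close>

primrec hit_prob :: "int pmf \<Rightarrow> nat pmf \<Rightarrow> nat \<Rightarrow> (nat \<Rightarrow> int list \<Rightarrow> bool) \<Rightarrow> int list \<Rightarrow> ennreal" where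
  "hit_prob a p 0 B xs = of_bool (B 0 xs)"
| "hit_prob a p (Suc K) B xs =
     (if B 0 xs then 1 else \<integral>\<^sup>+ys. hit_prob a p K (\<lambda>k. B (Suc k)) ys \<partial>brw_step a p xs)"

lemma ex_le_Suc_iff: "(\<exists>k\<le>Suc K. P k) \<longleftrightarrow> P 0 \<or> (\<exists>k\<le>K. P (Suc k))"
  by (metis Suc_le_mono le0 not0_implies_Suc)

text \<open>Conditioning on the first step identifies the recursion \<open>hit_prob\<close>. The
  time-dependent predicate \<open>B\<close> is shifted by one generation at every step, which suits
  inductions over time.\<close>

lemma emeasure_brw_path:
  "emeasure (brw_path a p K xs) {h. \<exists>k\<le>K. B k (h ! k)} = hit_prob a p K B xs"
proof (induction K arbitrary: B xs)
  case (Suc K)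
  have "emeasure (brw_path a p (Suc K) xs) {h. \<exists>k\<le>Suc K. B k (h ! k)} =
    (\<integral>\<^sup>+ys. \<integral>\<^sup>+g. indicator {h. \<exists>k\<le>Suc K. B k (h ! k)} (xs # g) \<partial>brw_path a p K ys \<partial>brw_step a p xs)"
    by (subst nn_integral_indicator[symmetric]) (simp_all add: brw_path.simps(2))
  also have "\<dots> = (\<integral>\<^sup>+ys. \<integral>\<^sup>+g. (if B 0 xs then 1 else indicator {h. \<exists>k\<le>K. B (Suc k) (h ! k)} g)
       \<partial>brw_path a p K ys \<partial>brw_step a p xs)"
    by (intro nn_integral_cong) (auto simp: indicator_def ex_le_Suc_iff)
  also have "\<dots> = hit_prob a p (Suc K) B xs"
    by (simp add: Suc.IH[symmetric] measure_pmf.emeasure_space_1[simplified])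
  finally show ?case .
qed (simp add: indicator_def)

lemma hit_prob_le_1: "hit_prob a p K B xs \<le> 1"
  unfolding emeasure_brw_path[symmetric] by (rule measure_pmf.emeasure_le_1)

text \<open>If \<open>B\<close> holds for the whole population at some time, it holds at that same
  time for both groups, and these evolve independently. So the event lies in the intersection of two
  independent ones.\<close>

lemma hit_prob_append:
  assumes "\<And>k xs ys. B k (xs @ ys) \<Longrightarrow> B k xs \<and> B k ys"
  shows "hit_prob a p K B (xs @ ys) \<le> hit_prob a p K B xs * hit_prob a p K B ys"
  using assms
proof (induction K arbitrary: B xs ys)
  case 0
  then have "B 0 (xs @ ys) \<Longrightarrow> B 0 xs \<and> B 0 ys" by blast
  then show ?case by (cases "B 0 (xs @ ys)") simp_all
next
  case (Suc K)
  let ?h = "hit_prob a p K (\<lambda>k. B (Suc k))"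
  note IH = Suc.IH[of "\<lambda>k. B (Suc k)", OF Suc.prems]
  have split: "(\<integral>\<^sup>+zs. ?h zs \<partial>brw_step a p (xs @ ys)) = (\<integral>\<^sup>+u. \<integral>\<^sup>+v. ?h (u @ v) \<partial>brw_step a p ys \<partial>brw_step a p xs)"
    by (simp add: brw_step_append)
  have 1: "(\<integral>\<^sup>+zs. ?h zs \<partial>brw_step a p (xs @ ys)) \<le> (\<integral>\<^sup>+u. ?h u \<partial>brw_step a p xs) * (\<integral>\<^sup>+v. ?h v \<partial>brw_step a p ys)"
  proof -
    have "(\<integral>\<^sup>+zs. ?h zs \<partial>brw_step a p (xs @ ys)) \<le> (\<integral>\<^sup>+u. \<integral>\<^sup>+v. ?h u * ?h v \<partial>brw_step a p ys \<partial>brw_step a p xs)"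
      unfolding split by (intro nn_integral_mono IH)
    then show ?thesis by (simp add: nn_integral_cmult nn_integral_multc)
  qed
  \<comment> \<open>These bounds serve the mixed case: \<open>B 0\<close> may hold for one group but
    not for the whole, and then the factor of that group is 1 while the other is still an
    integral.\<close>
  have I1: "(\<integral>\<^sup>+u. ?h u \<partial>brw_step a p zs) \<le> 1" for zs
    using nn_integral_mono[of "brw_step a p zs" ?h "\<lambda>_. 1"] hit_prob_le_1
    by (simp add: measure_pmf.emeasure_space_1[simplified])
  have 2: "(\<integral>\<^sup>+u. ?h u \<partial>brw_step a p xs) * (\<integral>\<^sup>+v. ?h v \<partial>brw_step a p ys) \<le> (\<integral>\<^sup>+v. ?h v \<partial>brw_step a p ys)"
    using mult_right_mono[OF I1[of xs]] by simp
  have 3: "(\<integral>\<^sup>+u. ?h u \<partial>brw_step a p xs) * (\<integral>\<^sup>+v. ?h v \<partial>brw_step a p ys) \<le> (\<integral>\<^sup>+v. ?h v \<partial>brw_step a p xs)"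
    using mult_left_mono[OF I1[of ys]] by simp
  show ?case
  proof (cases "B 0 (xs @ ys)")
    case True
    with Suc.prems[of 0 xs ys] show ?thesis by simp
  next
    case False
    then show ?thesis using 1 order_trans[OF 1 2] order_trans[OF 1 3] I1[of "xs @ ys"] by simp
  qed
qed

lemma hit_prob_le_prod_list:
  assumes "\<And>k xs ys. B k (xs @ ys) \<Longrightarrow> B k xs \<and> B k ys"
  shows "hit_prob a p K B xs \<le> prod_list (map (\<lambda>x. hit_prob a p K B [x]) xs)"
proof (induction xs)
  case Nil
  then show ?case by (simp add: hit_prob_le_1)
next
  case (Cons x xs)
  show ?case
    using order_trans[OF hit_prob_append[of B a p K "[x]" xs, OF assms] mult_left_mono[OF Cons.IH]] by simp
qed

text \<open>Markov property at generation \<open>j\<close>: as long as \<open>B\<close> cannot occur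
  before that time, the recursion only transports the population forward.\<close>

lemma hit_prob_skip:
  assumes "\<And>k ys. 0 < k \<Longrightarrow> k < j \<Longrightarrow> \<not> B k ys" "j > 0 \<Longrightarrow> \<not> B 0 xs"
  shows "hit_prob a p (j + K) B xs = (\<integral>\<^sup>+ys. hit_prob a p K (\<lambda>k. B (j + k)) ys \<partial>brw_iter a p j xs)"
  using assms
proof (induction j arbitrary: xs B)
  case (Suc j)
  have "hit_prob a p (j + K) (\<lambda>k. B (Suc k)) =
      (\<lambda>ys. \<integral>\<^sup>+zs. hit_prob a p K (\<lambda>k. B (Suc (j + k))) zs \<partial>brw_iter a p j ys)"
    using Suc.IH[of "\<lambda>k. B (Suc k)"] Suc.prems(1) by (intro ext) simp
  then show ?case using Suc.prems(2) by simp
qed simp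

section \<open>Independence of the generations\<close>

lemma prob_space_reproduction_space: "prob_space (reproduction_space a p)"
  unfolding reproduction_space_def by (intro prob_space_PiM measure_pmf.prob_space_axioms)

lemma space_reproduction_space [simp]: "space (reproduction_space a p) = UNIV"
  by (simp add: reproduction_space_def space_PiM PiE_UNIV_domain)

lemma distr_reproduction:
  "distr (reproduction_space a p) (measure_pmf (pair_pmf a p)) (\<lambda>\<omega>. \<omega> j) = measure_pmf (pair_pmf a p)"
  unfolding reproduction_space_def
  by (rule product_prob_space.PiM_component)
     (auto intro!: product_prob_spaceI measure_pmf.prob_space_axioms)

lemma indep_vars_reproduction_space:
  "prob_space.indep_vars (reproduction_space a p) (\<lambda>_. measure_pmf (pair_pmf a p)) (\<lambda>j \<omega>. \<omega> j) UNIV"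
proof -
  interpret prob_space "reproduction_space a p" by (rule prob_space_reproduction_space)
  have "distr (reproduction_space a p) (\<Pi>\<^sub>M i\<in>UNIV. measure_pmf (pair_pmf a p)) (\<lambda>x. \<lambda>i\<in>UNIV. x i) =
      distr (reproduction_space a p) (reproduction_space a p) (\<lambda>x. x)"
    by (intro distr_cong) (auto simp: reproduction_space_def)
  also have "\<dots> = (\<Pi>\<^sub>M i\<in>UNIV. distr (reproduction_space a p) (measure_pmf (pair_pmf a p)) (\<lambda>\<omega>. \<omega> i))"
    by (simp add: distr_id distr_reproduction) (simp add: reproduction_space_def)
  finally have "distr (reproduction_space a p) (\<Pi>\<^sub>M i\<in>UNIV. measure_pmf (pair_pmf a p)) (\<lambda>x. \<lambda>i\<in>UNIV. x i) =
      (\<Pi>\<^sub>M i\<in>UNIV. distr (reproduction_space a p) (measure_pmf (pair_pmf a p)) (\<lambda>\<omega>. \<omega> i))" .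
  then show ?thesis
    using indep_vars_iff_distr_eq_PiM'[of UNIV "\<lambda>j \<omega>. \<omega> j" "\<lambda>_. measure_pmf (pair_pmf a p)"]
    by (simp add: restrict_UNIV)
qed

text \<open>Disjoint blocks of coordinates of a product measure are independent; the work lies in
  passing from functions of the whole family to functions of its restrictions.\<close>

lemma indep_reproduction_space:
  fixes f :: "(nat \<times> nat \<Rightarrow> int \<times> nat) \<Rightarrow> 'a" and g :: "(nat \<times> nat \<Rightarrow> int \<times> nat) \<Rightarrow> 'b"
  assumes f: "f \<in> reproduction_space a p \<rightarrow>\<^sub>M count_space UNIV"
    and g: "g \<in> reproduction_space a p \<rightarrow>\<^sub>M count_space UNIV"
    and fA: "\<And>\<omega> \<omega>'. (\<And>j. j \<in> A \<Longrightarrow> \<omega> j = \<omega>' j) \<Longrightarrow> f \<omega> = f \<omega>'"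
    and gB: "\<And>\<omega> \<omega>'. (\<And>j. j \<in> B \<Longrightarrow> \<omega> j = \<omega>' j) \<Longrightarrow> g \<omega> = g \<omega>'"
    and AB: "A \<inter> B = {}"
  shows "emeasure (reproduction_space a p) {\<omega>. f \<omega> = u \<and> g \<omega> = v} =
    emeasure (reproduction_space a p) {\<omega>. f \<omega> = u} * emeasure (reproduction_space a p) {\<omega>. g \<omega> = v}"
proof -
  interpret prob_space "reproduction_space a p" by (rule prob_space_reproduction_space)
  let ?M = "measure_pmf (pair_pmf a p)"
  \<comment> \<open>\<open>e\<close> extends a restricted family by the dummy pair
    \<open>(0, 0)\<close>; as \<open>f\<close> and \<open>g\<close> read only the coordinates in
    \<open>A\<close> and \<open>B\<close>, their values do not change.\<close>
  define e where "e C \<omega> = (\<lambda>j. if j \<in> C then \<omega> j else (0, 0))" for C and \<omega> :: "nat \<times> nat \<Rightarrow> int \<times> nat"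
  have e: "e C \<in> (\<Pi>\<^sub>M j\<in>C. ?M) \<rightarrow>\<^sub>M reproduction_space a p" for C
    unfolding reproduction_space_def e_def
  proof (rule measurable_PiM_single')
    fix j :: "nat \<times> nat"
    show "(\<lambda>\<omega>. if j \<in> C then \<omega> j else (0, 0)) \<in> (\<Pi>\<^sub>M j\<in>C. ?M) \<rightarrow>\<^sub>M ?M"
      using measurable_component_singleton[of j C "\<lambda>_. ?M"] by (cases "j \<in> C") simp_all
  qed (auto simp: space_PiM)
  have "indep_var (\<Pi>\<^sub>M j\<in>A. ?M) (\<lambda>\<omega>. restrict (\<lambda>j. \<omega> j) A) (\<Pi>\<^sub>M j\<in>B. ?M) (\<lambda>\<omega>. restrict (\<lambda>j. \<omega> j) B)"
    by (rule indep_var_restrict[OF indep_vars_reproduction_space AB]) auto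
  moreover have "(\<lambda>\<omega>. f \<omega> = u) \<circ> e A \<in> (\<Pi>\<^sub>M j\<in>A. ?M) \<rightarrow>\<^sub>M count_space UNIV"
    by (rule measurable_comp[OF e]) (rule measurable_compose[OF f], simp)
  moreover have "(\<lambda>\<omega>. g \<omega> = v) \<circ> e B \<in> (\<Pi>\<^sub>M j\<in>B. ?M) \<rightarrow>\<^sub>M count_space UNIV"
    by (rule measurable_comp[OF e]) (rule measurable_compose[OF g], simp)
  ultimately have "indep_var (count_space UNIV) (((\<lambda>\<omega>. f \<omega> = u) \<circ> e A) \<circ> (\<lambda>\<omega>. restrict (\<lambda>j. \<omega> j) A))
      (count_space UNIV) (((\<lambda>\<omega>. g \<omega> = v) \<circ> e B) \<circ> (\<lambda>\<omega>. restrict (\<lambda>j. \<omega> j) B))"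
    by (rule indep_var_compose)
  moreover have "f (e A (restrict \<omega> A)) = f \<omega>" "g (e B (restrict \<omega> B)) = g \<omega>" for \<omega>
    by (auto simp: e_def intro!: fA gB)
  ultimately have "indep_var (count_space UNIV) (\<lambda>\<omega>. f \<omega> = u) (count_space UNIV) (\<lambda>\<omega>. g \<omega> = v)"
    by (simp add: comp_def)
  from indep_varD[OF this, of "{True}" "{True}"]
  show ?thesis
    by (simp add: emeasure_eq_measure vimage_def ennreal_mult'[symmetric] Int_def)
qed

text \<open>Freezing: given that \<open>f\<close> takes the value \<open>u\<close>, the variable
  \<open>g u\<close> keeps its law because it reads other coordinates. Countability lets the
  two-stage law be checked on single points.\<close>

lemma distr_reproduction_space_bind:
  fixes f :: "(nat \<times> nat \<Rightarrow> int \<times> nat) \<Rightarrow> 'a :: countable" and g :: "'a \<Rightarrow> (nat \<times> nat \<Rightarrow> int \<times> nat) \<Rightarrow> 'b :: countable"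
  assumes f: "f \<in> reproduction_space a p \<rightarrow>\<^sub>M count_space UNIV"
    and g: "\<And>u. g u \<in> reproduction_space a p \<rightarrow>\<^sub>M count_space UNIV"
    and fA: "\<And>\<omega> \<omega>'. (\<And>j. j \<in> A \<Longrightarrow> \<omega> j = \<omega>' j) \<Longrightarrow> f \<omega> = f \<omega>'"
    and gB: "\<And>u \<omega> \<omega>'. (\<And>j. j \<in> B \<Longrightarrow> \<omega> j = \<omega>' j) \<Longrightarrow> g u \<omega> = g u \<omega>'"
    and AB: "A \<inter> B = {}"
    and P: "distr (reproduction_space a p) (count_space UNIV) f = measure_pmf P"
    and Q: "\<And>u. distr (reproduction_space a p) (count_space UNIV) (g u) = measure_pmf (Q u)"
  shows "distr (reproduction_space a p) (count_space UNIV) (\<lambda>\<omega>. h (f \<omega>) (g (f \<omega>) \<omega>)) =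
    measure_pmf (bind_pmf P (\<lambda>u. map_pmf (h u) (Q u)))"
proof -
  let ?\<Omega> = "reproduction_space a p"
  have fg: "(\<lambda>\<omega>. (f \<omega>, g (f \<omega>) \<omega>)) \<in> ?\<Omega> \<rightarrow>\<^sub>M count_space UNIV"
    by (rule measurable_compose_countable[where f = "\<lambda>u \<omega>. (u, g u \<omega>)", OF _ f])
       (rule measurable_compose[OF g], simp)
  have "distr ?\<Omega> (count_space UNIV) (\<lambda>\<omega>. (f \<omega>, g (f \<omega>) \<omega>)) =
      measure_pmf (bind_pmf P (\<lambda>u. map_pmf (Pair u) (Q u)))" (is "?L = ?R")
  proof (rule measure_eqI_countable)
    fix uv :: "'a \<times> 'b"
    obtain u v where uv: "uv = (u, v)" by (cases uv)
    have "emeasure ?L {uv} = emeasure ?\<Omega> {\<omega>. f \<omega> = u \<and> g u \<omega> = v}"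
      by (subst emeasure_distr[OF fg]) (auto simp: uv intro!: arg_cong2[where f = emeasure])
    also have "\<dots> = emeasure ?\<Omega> {\<omega>. f \<omega> = u} * emeasure ?\<Omega> {\<omega>. g u \<omega> = v}"
      by (rule indep_reproduction_space[OF f g fA gB AB])
    also have "emeasure ?\<Omega> {\<omega>. f \<omega> = u} = emeasure P {u}"
      unfolding P[symmetric] by (subst emeasure_distr[OF f]) (auto simp: vimage_def)
    also have "emeasure ?\<Omega> {\<omega>. g u \<omega> = v} = emeasure (Q u) {v}"
      unfolding Q[symmetric] by (subst emeasure_distr[OF g]) (auto simp: vimage_def)
    also have "emeasure P {u} * emeasure (Q u) {v} = (\<integral>\<^sup>+x. emeasure (Q u) {v} * indicator {u} x \<partial>P)"
      by (subst nn_integral_cmult_indicator) (simp_all add: mult.commute)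
    also have "\<dots> = (\<integral>\<^sup>+x. emeasure (map_pmf (Pair x) (Q x)) {uv} \<partial>P)"
      by (intro nn_integral_cong) (auto simp: uv indicator_def vimage_def)
    also have "\<dots> = emeasure ?R {uv}" by simp
    finally show "emeasure ?L {uv} = emeasure ?R {uv}" .
  qed (auto)
  then have "distr ?L (count_space UNIV) (\<lambda>(u, v). h u v) =
      measure_pmf (map_pmf (\<lambda>(u, v). h u v) (bind_pmf P (\<lambda>u. map_pmf (Pair u) (Q u))))"
    by (simp add: map_pmf_rep_eq)
  then show ?thesis
    by (subst (asm) distr_distr[OF _ fg]) (simp_all add: map_bind_pmf pmf.map_comp o_def)
qed

text \<open>Distinct indices ensure that every pair \<open>\<omega> (k, i)\<close> serves one
  particle only, so the head of the list splits off as independent of the rest.\<close>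

lemma distr_offspring:
  assumes "distinct is"
  shows "distr (reproduction_space a p) (count_space UNIV)
      (\<lambda>\<omega>. concat (map (\<lambda>i. replicate (snd (\<omega> (k, i))) (xs ! i + fst (\<omega> (k, i)))) is))
    = measure_pmf (brw_step a p (map ((!) xs) is))"
  using assms
proof (induction "is")
  case Nil
  interpret prob_space "reproduction_space a p" by (rule prob_space_reproduction_space)
  show ?case by (simp add: return_pmf.rep_eq)
next
  case (Cons i "is")
  have "distr (reproduction_space a p) (count_space UNIV) (\<lambda>\<omega>. \<omega> (k, i)) = measure_pmf (pair_pmf a p)"
    using distr_reproduction[of a p "(k, i)"] by (subst distr_cong[OF refl sets_measure_pmf_count_space[symmetric] refl])
  then have "distr (reproduction_space a p) (count_space UNIV)
      (\<lambda>\<omega>. (\<lambda>jb ys. replicate (snd jb) (xs ! i + fst jb) @ ys) (\<omega> (k, i))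
          (concat (map (\<lambda>i. replicate (snd (\<omega> (k, i))) (xs ! i + fst (\<omega> (k, i)))) is)))
    = measure_pmf (bind_pmf (pair_pmf a p) (\<lambda>jb. map_pmf (\<lambda>ys. replicate (snd jb) (xs ! i + fst jb) @ ys)
        (brw_step a p (map ((!) xs) is))))"
    using Cons
    by (intro distr_reproduction_space_bind[where A = "{(k, i)}" and B = "{k} \<times> set is"
          and g = "\<lambda>_ \<omega>. concat (map (\<lambda>i. replicate (snd (\<omega> (k, i))) (xs ! i + fst (\<omega> (k, i)))) is)"]
        measurable_reproduction measurable_offspring)
       (auto intro!: arg_cong[where f = concat])
  then show ?case by simp
qed

lemma particles_cong:
  "(\<And>l i. l < k \<Longrightarrow> \<omega> (l, i) = \<omega>' (l, i)) \<Longrightarrow> particles n \<omega> k = particles n \<omega>' k"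
  by (induction k) simp_all

lemma measurable_history:
  "(\<lambda>\<omega>. map (particles n \<omega>) is) \<in> reproduction_space a p \<rightarrow>\<^sub>M count_space UNIV"
proof (induction "is")
  case (Cons i "is")
  show ?case
    unfolding list.map
    by (rule measurable_compose_countable[where f = "\<lambda>ys \<omega>. particles n \<omega> i # ys", OF _ Cons.IH])
       (rule measurable_compose[OF measurable_particles], simp)
qed simp

text \<open>Bridge between the process on \<open>reproduction_space\<close> and the chain on lists:
  the generations up to \<open>k\<close> read only rows below \<open>k\<close>, so row
  \<open>k\<close> is fresh randomness for the next step.\<close>

lemma distr_history:
  "distr (reproduction_space a p) (count_space UNIV) (\<lambda>\<omega>. map (particles n \<omega>) [0..<Suc k])
    = measure_pmf (brw_path a p k (replicate n 0))"
proof (induction k)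
  case 0
  interpret prob_space "reproduction_space a p" by (rule prob_space_reproduction_space)
  show ?case by (simp add: return_pmf.rep_eq)
next
  case (Suc k)
  define g where "g h \<omega> = concat (map (\<lambda>i. replicate (snd (\<omega> (k, i))) (last h ! i + fst (\<omega> (k, i))))
      [0..<length (last h)])" for h :: "int list list" and \<omega> :: "nat \<times> nat \<Rightarrow> int \<times> nat"
  have "distr (reproduction_space a p) (count_space UNIV)
      (\<lambda>\<omega>. (\<lambda>h y. h @ [y]) (map (particles n \<omega>) [0..<Suc k]) (g (map (particles n \<omega>) [0..<Suc k]) \<omega>))
    = measure_pmf (bind_pmf (brw_path a p k (replicate n 0)) (\<lambda>h. map_pmf (\<lambda>y. h @ [y]) (brw_step a p (last h))))"
  proof (rule distr_reproduction_space_bind[where A = "{..<k} \<times> UNIV" and B = "{k} \<times> UNIV"])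
    show "map (particles n \<omega>) [0..<Suc k] = map (particles n \<omega>') [0..<Suc k]"
      if "\<And>j. j \<in> {..<k} \<times> UNIV \<Longrightarrow> \<omega> j = \<omega>' j" for \<omega> \<omega>'
      using that by (intro map_cong refl particles_cong) auto
    show "distr (reproduction_space a p) (count_space UNIV) (g h) = measure_pmf (brw_step a p (last h))" for h
      unfolding g_def by (subst distr_offspring) (simp_all add: map_nth)
  qed (auto simp: g_def Suc.IH intro!: measurable_history measurable_offspring simp del: upt_Suc)
  then show ?case
    unfolding brw_path_snoc by (simp add: g_def)
qed

section \<open>Generating functions and the block argument\<close>

lemma prod_list_le_power_filter:
  fixes h :: "'a \<Rightarrow> ennreal"
  assumes "\<And>z. z \<in> set ys \<Longrightarrow> P z \<Longrightarrow> h z \<le> s" "\<And>z. h z \<le> 1"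
  shows "prod_list (map h ys) \<le> s ^ length (filter P ys)"
  using assms(1)
proof (induction ys)
  case (Cons y ys)
  then have IH: "prod_list (map h ys) \<le> s ^ length (filter P ys)" by simp
  show ?case
    using mult_mono[OF _ IH, of "h y" s] mult_mono[OF assms(2) IH, of y] Cons.prems[of y] by auto
qed simp

text \<open>Failure within \<open>K + 1\<close> blocks forces each descendant that has advanced by
  \<open>V\<close> after \<open>L\<close> generations to fail within \<open>K\<close> blocks. These
  descendants are independent, so by induction the probability is at most the expectation of
  \<open>s\<close> to the power of their number, hence at most \<open>s\<close>. Allowing any start
  \<open>x\<close> above the line \<open>y\<close> lets the induction restart from all of
  them.\<close>

lemma hit_prob_block:
  fixes L :: nat and V :: int and s :: ennreal
  assumes L: "L > 0" and s1: "s \<le> 1"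
    and s: "(\<integral>\<^sup>+ys. s ^ length (filter (\<lambda>z. V \<le> z) ys) \<partial>brw_iter a p L [0]) \<le> s"
  shows "y \<le> x \<Longrightarrow>
    hit_prob a p (K * L) (\<lambda>k xs. L dvd k \<and> (\<forall>z\<in>set xs. z < y + V * int (k div L))) [x] \<le> s"
proof (induction K arbitrary: x y)
  case (Suc K)
  define B where "B y k xs \<longleftrightarrow> L dvd k \<and> (\<forall>z\<in>set xs. z < y + V * int (k div L))" for y k xs
  have IH: "hit_prob a p (K * L) (B (y + V)) [z] \<le> s" if "y + V \<le> z" for z
    using Suc.IH[OF that] unfolding B_def .
  have shift: "(\<lambda>k. B y (L + k)) = B (y + V)"
    using L by (auto simp: B_def fun_eq_iff algebra_simps)
  have anti: "B y k (us @ vs) \<Longrightarrow> B y k us \<and> B y k vs" for y k us vs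
    by (auto simp: B_def)
  have "hit_prob a p (Suc K * L) (B y) [x] = (\<integral>\<^sup>+ys. hit_prob a p (K * L) (B (y + V)) ys \<partial>brw_iter a p L [x])"
    unfolding mult_Suc using Suc.prems by (subst hit_prob_skip) (auto simp: shift B_def dest: nat_dvd_not_less)
  also have "\<dots> \<le> (\<integral>\<^sup>+ys. s ^ length (filter (\<lambda>z. y + V \<le> z) ys) \<partial>brw_iter a p L [x])"
  proof (rule nn_integral_mono)
    fix ys
    have "hit_prob a p (K * L) (B (y + V)) ys \<le> prod_list (map (\<lambda>z. hit_prob a p (K * L) (B (y + V)) [z]) ys)"
      by (rule hit_prob_le_prod_list) (rule anti)
    also have "\<dots> \<le> s ^ length (filter (\<lambda>z. y + V \<le> z) ys)"
      by (rule prod_list_le_power_filter) (auto intro: IH hit_prob_le_1)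
    finally show "hit_prob a p (K * L) (B (y + V)) ys \<le> s ^ length (filter (\<lambda>z. y + V \<le> z) ys)" .
  qed
  also have "\<dots> = (\<integral>\<^sup>+ys. s ^ length (filter (\<lambda>z. y + V \<le> x + z) ys) \<partial>brw_iter a p L [0])"
    using brw_iter_translate[of a p L x "[0]"] by (simp add: filter_map o_def)
  also have "\<dots> \<le> (\<integral>\<^sup>+ys. s ^ length (filter (\<lambda>z. V \<le> z) ys) \<partial>brw_iter a p L [0])"
  proof -
    have "length (filter (\<lambda>z. V \<le> z) ys) \<le> length (filter (\<lambda>z. y + V \<le> x + z) ys)" for ys
      using Suc.prems by (induction ys) auto
    then show ?thesis using s1 by (intro nn_integral_mono power_decreasing) auto
  qed
  also note s
  finally show ?case by (simp add: B_def[abs_def])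
qed (simp)

text \<open>At generation \<open>j\<close> every particle lies at or above \<open>- r * j\<close>,
  so each one starts its own block argument from that level, and independence multiplies the bounds
  \<open>s\<close>.\<close>

lemma hit_prob_shifted_block:
  fixes L :: nat and V r :: int and s :: ennreal
  assumes L: "L > 0" and s1: "s \<le> 1"
    and s: "(\<integral>\<^sup>+ys. s ^ length (filter (\<lambda>z. V \<le> z) ys) \<partial>brw_iter a p L [0]) \<le> s"
    and r: "\<And>j. j \<in> set_pmf a \<Longrightarrow> \<bar>j\<bar> \<le> r"
  shows "hit_prob a p (j + K * L)
      (\<lambda>k xs. j \<le> k \<and> L dvd (k - j) \<and> (\<forall>z\<in>set xs. z < - r * int j + V * int ((k - j) div L))) (replicate n 0)
    \<le> (\<integral>\<^sup>+ys. s ^ length ys \<partial>brw_iter a p j (replicate n 0))"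
proof (subst hit_prob_skip)
  let ?B = "\<lambda>k xs. L dvd k \<and> (\<forall>z\<in>set xs. z < - r * int j + V * int (k div L))"
  show "(\<integral>\<^sup>+ys. hit_prob a p (K * L) (\<lambda>k xs. j \<le> j + k \<and> L dvd (j + k - j) \<and>
      (\<forall>z\<in>set xs. z < - r * int j + V * int ((j + k - j) div L))) ys \<partial>brw_iter a p j (replicate n 0))
    \<le> (\<integral>\<^sup>+ys. s ^ length ys \<partial>brw_iter a p j (replicate n 0))"
  proof (intro nn_integral_mono_AE AE_pmfI)
    fix ys assume ys: "ys \<in> set_pmf (brw_iter a p j (replicate n 0))"
    have lower: "- r * int j \<le> z" if "z \<in> set ys" for z
      using set_brw_iter_lower[OF r ys _ that, where l = 0] by simp
    have "hit_prob a p (K * L) ?B ys \<le> prod_list (map (\<lambda>z. hit_prob a p (K * L) ?B [z]) ys)"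
      by (rule hit_prob_le_prod_list) auto
    also have "\<dots> \<le> s ^ length (filter (\<lambda>_. True) ys)"
      by (rule prod_list_le_power_filter) (blast intro: hit_prob_block[OF L s1 s] hit_prob_le_1 lower)+
    finally show "hit_prob a p (K * L) (\<lambda>k xs. j \<le> j + k \<and> L dvd (j + k - j) \<and>
      (\<forall>z\<in>set xs. z < - r * int j + V * int ((j + k - j) div L))) ys \<le> s ^ length ys"
      by simp
  qed
qed auto

section \<open>Generating functions with mean above one\<close>

text \<open>With \<open>G\<close> the generating function, \<open>(1 - G s) / (1 - s)\<close> is the
  expectation of \<open>\<Sum>i<N. s ^ i\<close>. By monotone convergence it increases to the mean,
  finite or not, as \<open>s\<close> tends to 1, so it exceeds 1 for some \<open>s < 1\<close>,
  which gives \<open>G s \<le> s\<close>.\<close>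

lemma ex_generating_function_le:
  fixes q :: "nat pmf"
  assumes "1 < (\<integral>\<^sup>+N. of_nat N \<partial>q)"
  shows "\<exists>s::real. 0 < s \<and> s < 1 \<and> (\<integral>\<^sup>+N. ennreal s ^ N \<partial>q) \<le> ennreal s"
proof -
  define \<rho> :: "nat \<Rightarrow> real" where "\<rho> k = 1 - 1 / (real k + 2)" for k
  have \<rho>: "0 < \<rho> k" "\<rho> k < 1" for k by (auto simp: \<rho>_def field_simps)
  have \<rho>_mono: "\<rho> k \<le> \<rho> l" if "k \<le> l" for k l using that by (auto simp: \<rho>_def field_simps)
  have \<rho>_lim: "\<rho> \<longlonglongrightarrow> 1" unfolding \<rho>_def by real_asymp
  define g :: "nat \<Rightarrow> nat \<Rightarrow> ennreal" where "g k N = ennreal (\<Sum>i<N. \<rho> k ^ i)" for k N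
  have inc: "incseq g"
    unfolding g_def incseq_def le_fun_def
    by (intro allI impI ennreal_leI sum_mono power_mono \<rho>_mono) (use \<rho> in \<open>auto intro: less_imp_le\<close>)
  have "(SUP k. g k N) = of_nat N" for N
  proof (rule LIMSEQ_unique[OF LIMSEQ_SUP])
    show "incseq (\<lambda>k. g k N)" using inc by (auto simp: incseq_def le_fun_def)
    have "(\<lambda>k. \<Sum>i<N. \<rho> k ^ i) \<longlonglongrightarrow> (\<Sum>i<N. 1 ^ i)" by (intro tendsto_intros \<rho>_lim)
    then show "(\<lambda>k. g k N) \<longlonglongrightarrow> of_nat N"
      unfolding g_def ennreal_of_nat_eq_real_of_nat by (intro tendsto_ennrealI) simp
  qed
  then have "(\<integral>\<^sup>+N. of_nat N \<partial>q) = (SUP k. \<integral>\<^sup>+N. g k N \<partial>q)"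
    using nn_integral_monotone_convergence_SUP[of g "measure_pmf q"] inc by (simp add: SUP_apply)
  with assms obtain k where k: "1 < (\<integral>\<^sup>+N. g k N \<partial>q)" by (auto simp: less_SUP_iff)
  let ?s = "\<rho> k"
  have "ennreal ?s ^ N + ennreal (1 - ?s) * g k N = 1" for N
  proof -
    have "?s ^ N + (1 - ?s) * (\<Sum>i<N. ?s ^ i) = 1" using one_diff_power_eq[of ?s N] by simp
    moreover have "0 \<le> (\<Sum>i<N. ?s ^ i)" using \<rho>[of k] by (intro sum_nonneg) auto
    ultimately show ?thesis
      using \<rho>[of k] by (simp add: g_def ennreal_power ennreal_mult'[symmetric] ennreal_plus[symmetric] del: ennreal_plus)
  qed
  then have "(\<integral>\<^sup>+N. ennreal ?s ^ N + ennreal (1 - ?s) * g k N \<partial>q) = 1"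
    by (simp add: measure_pmf.emeasure_space_1[simplified])
  then have eq: "(\<integral>\<^sup>+N. ennreal ?s ^ N \<partial>q) + ennreal (1 - ?s) * (\<integral>\<^sup>+N. g k N \<partial>q) = 1"
    by (simp add: nn_integral_add nn_integral_cmult)
  have "(\<integral>\<^sup>+N. ennreal ?s ^ N \<partial>q) + ennreal (1 - ?s) \<le> 1"
    unfolding eq[symmetric] using k mult_left_mono[of 1 "\<integral>\<^sup>+N. g k N \<partial>q" "ennreal (1 - ?s)"]
    by (intro add_left_mono) auto
  also have "1 = ennreal ?s + ennreal (1 - ?s)"
    using \<rho>[of k] by (simp add: ennreal_plus[symmetric] del: ennreal_plus)
  finally have "(\<integral>\<^sup>+N. ennreal ?s ^ N \<partial>q) \<le> ennreal ?s"
    by (simp add: add.commute[of _ "ennreal (1 - ?s)"] ennreal_add_left_cancel_le)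
  with \<rho>[of k] show ?thesis by blast
qed

lemma nn_integral_power_pmf:
  fixes q :: "nat pmf"
  assumes "0 \<le> s" "s \<le> 1"
  shows "(\<integral>\<^sup>+N. ennreal s ^ N \<partial>q) = ennreal (measure_pmf.expectation q (\<lambda>N. s ^ N))"
  using assms unfolding ennreal_power[OF assms(1)]
  by (intro nn_integral_eq_integral measure_pmf.integrable_const_bound[where B = 1]) (auto simp: power_le_one)

text \<open>Iterates from 0 increase to a fixed point \<open>e\<close>, and \<open>e < 1\<close>
  because \<open>s1\<close> with \<open>f s1 \<le> s1\<close> is a barrier. Strictly between
  \<open>e\<close> and 1 the function lies below the diagonal, so iterates from there decrease to
  \<open>e\<close>; the other starting points are squeezed in by monotonicity.\<close>

lemma generating_function_iterates:
  fixes q :: "nat pmf"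
  assumes mean: "1 < (\<integral>\<^sup>+N. of_nat N \<partial>q)"
  shows "\<exists>e::real. 0 \<le> e \<and> e < 1 \<and>
    (\<forall>s\<in>{0..<1}. (\<lambda>j. ((\<lambda>s. measure_pmf.expectation q (\<lambda>N. s ^ N)) ^^ j) s) \<longlonglongrightarrow> e)"
proof -
  define f :: "real \<Rightarrow> real" where "f s = measure_pmf.expectation q (\<lambda>N. s ^ N)" for s
  have int: "integrable q (\<lambda>N. s ^ N)" if "0 \<le> s" "s \<le> 1" for s :: real
    using that by (intro measure_pmf.integrable_const_bound[where B = 1]) (auto simp: power_le_one)
  have mono: "f s \<le> f t" if "0 \<le> s" "s \<le> t" "t \<le> 1" for s t
    unfolding f_def using that by (intro integral_mono int power_mono) auto
  have f1: "f 1 = 1" by (simp add: f_def)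
  have f0: "0 \<le> f s" if "0 \<le> s" for s unfolding f_def using that by (intro integral_nonneg_AE) auto
  have cont: "(\<lambda>j. f (s j)) \<longlonglongrightarrow> f t" if "s \<longlonglongrightarrow> t" "\<And>j. 0 \<le> s j \<and> s j \<le> 1" for s t
    unfolding f_def
    by (rule integral_dominated_convergence[where w = "\<lambda>_. 1"])
       (use that in \<open>auto intro!: tendsto_intros simp: power_le_one\<close>)
  obtain s1 where s1: "0 < s1" "s1 < 1" "f s1 \<le> s1"
    using ex_generating_function_le[OF mean] by (auto simp: nn_integral_power_pmf f_def)
  \<comment> \<open>Some value of at least 2 has positive probability, since the mean exceeds 1; it
    makes the comparison in \<open>strict\<close> strict.\<close>
  obtain i0 where i0: "i0 \<in> set_pmf q" "2 \<le> i0"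
  proof (rule ccontr)
    assume "\<not> thesis"
    with that have "\<forall>i\<in>set_pmf q. i < 2" by (meson not_le)
    then have "(\<integral>\<^sup>+N. of_nat N \<partial>q) \<le> (\<integral>\<^sup>+N. 1 \<partial>q)"
      by (intro nn_integral_mono_AE AE_pmfI) (auto simp: less_2_cases_iff)
    with mean show False by (simp add: measure_pmf.emeasure_space_1[simplified])
  qed
  \<comment> \<open>\<open>(1 - f s) / (1 - s)\<close> is the expectation of \<open>\<Sum>i<N. s ^ i\<close>, which strictly increases in \<open>s\<close>.\<close>
  have strict: "f t < t" if st: "0 \<le> s" "s < t" "t < 1" and fs: "f s \<le> s" for s t
  proof -
    define D where "D N = (1 - s) * (1 - t ^ N) - (1 - t) * (1 - s ^ N)" for N :: nat
    have D_eq: "D N = (1 - s) * (1 - t) * (\<Sum>i<N. t ^ i - s ^ i)" for N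
      unfolding D_def one_diff_power_eq by (simp add: sum_subtractf algebra_simps)
    have D0: "0 \<le> D N" for N
      unfolding D_eq using st by (intro mult_nonneg_nonneg sum_nonneg) (auto intro: power_mono)
    have "0 < (\<Sum>i<i0. t ^ i - s ^ i)"
      using st i0 by (intro sum_pos2[where i = 1]) (auto intro: power_mono)
    then have Di: "0 < D i0" unfolding D_eq using st by simp
    have intD: "integrable q D" unfolding D_def using st by (auto intro!: int Bochner_Integration.integrable_diff)
    have "0 < D i0 * pmf q i0" using Di i0 by (simp add: pmf_positive)
    also have "\<dots> = measure_pmf.expectation q (\<lambda>N. D i0 * indicator {i0} N)" by (simp add: pmf.rep_eq)
    also have "\<dots> \<le> measure_pmf.expectation q D"
    proof (rule integral_mono)
      show "integrable q (\<lambda>N. D i0 * indicator {i0} N)"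
        using Di by (intro measure_pmf.integrable_const_bound[where B = "D i0"]) (auto simp: indicator_def)
    qed (use intD D0 in \<open>auto simp: indicator_def\<close>)
    also have "\<dots> = (1 - s) * (1 - f t) - (1 - t) * (1 - f s)"
      unfolding D_def f_def using st by (simp add: int)
    finally have "(1 - t) * (1 - f s) < (1 - s) * (1 - f t)" by simp
    moreover have "(1 - t) * (1 - s) \<le> (1 - t) * (1 - f s)" using st fs by (intro mult_left_mono) auto
    ultimately have "(1 - s) * (1 - t) < (1 - s) * (1 - f t)" by (simp add: mult.commute)
    then show ?thesis using st by simp
  qed
  have it01: "0 \<le> (f ^^ j) s \<and> (f ^^ j) s \<le> 1" if "0 \<le> s" "s \<le> 1" for j s
  proof (induction j)
    case (Suc j)
    then show ?case using f0 mono[of "(f ^^ j) s" 1] f1 by simp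
  qed (use that in simp)
  have it_mono: "(f ^^ j) s \<le> (f ^^ j) t" if "0 \<le> s" "s \<le> t" "t \<le> 1" for j s t
  proof (induction j)
    case (Suc j)
    then show ?case using that it01[of s j] it01[of t j] by (auto intro: mono)
  qed (use that in simp)
  have fix_lim: "f l = l" if "(\<lambda>j. (f ^^ j) s) \<longlonglongrightarrow> l" "0 \<le> s" "s \<le> 1" for l s
    using LIMSEQ_unique[OF cont[OF that(1) it01[OF that(2,3)]]] LIMSEQ_Suc[OF that(1)] by simp
  have inc: "incseq (\<lambda>j. (f ^^ j) 0)"
    unfolding incseq_Suc_iff
  proof
    fix j show "(f ^^ j) 0 \<le> (f ^^ Suc j) 0"
      using it_mono[of 0 "f 0" j] f0[of 0] mono[of 0 1] f1 by (simp add: funpow_swap1)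
  qed
  have bound: "(f ^^ j) s \<le> t" if "0 \<le> s" "s \<le> t" "t \<le> 1" "f t \<le> t" for j s t
  proof (induction j)
    case (Suc j)
    then show ?case using that it01[of s j] mono[of "(f ^^ j) s" t] by simp
  qed (use that in simp)
  obtain e where e: "(\<lambda>j. (f ^^ j) 0) \<longlonglongrightarrow> e" "\<And>j. (f ^^ j) 0 \<le> e"
    using incseq_convergent[OF inc] bound[of 0 s1] s1 by (metis less_imp_le order_refl)
  have e1: "e \<le> s1" using LIMSEQ_le_const2[OF e(1)] bound[of 0 s1] s1 by auto
  have e0: "0 \<le> e" using e(2)[of 0] by simp
  have fe: "f e = e" using fix_lim[OF e(1)] by simp
  have "(\<lambda>j. (f ^^ j) s) \<longlonglongrightarrow> e" if s: "0 \<le> s" "s < 1" for s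
  proof -
    \<comment> \<open>Starting from \<open>max s e\<close> keeps the upper iterates between the
      fixed point and 1, where \<open>strict\<close> applies.\<close>
    define t where "t = max s e"
    have t: "s \<le> t" "e \<le> t" "t < 1" using s e1 s1 by (auto simp: t_def)
    have ft: "f t \<le> t"
      using strict[OF e0, of t] t fe by (cases "t = e") auto
    have dec: "decseq (\<lambda>j. (f ^^ j) t)"
      unfolding decseq_Suc_iff
    proof
      fix j show "(f ^^ Suc j) t \<le> (f ^^ j) t"
        using it_mono[of "f t" t j] f0[of t] ft t e0 by (simp add: funpow_swap1)
    qed
    have lower: "e \<le> (f ^^ j) t" for j
    proof -
      have "(f ^^ j) e = e" by (induction j) (simp_all add: fe)
      then show ?thesis using it_mono[of e t j] t e0 by simp
    qed
    obtain l where l: "(\<lambda>j. (f ^^ j) t) \<longlonglongrightarrow> l" "\<And>j. l \<le> (f ^^ j) t"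
      using decseq_convergent[OF dec] lower by metis
    have fl: "f l = l" using fix_lim[OF l(1)] t e0 by simp
    have "e \<le> l" using LIMSEQ_le_const[OF l(1)] lower by auto
    moreover have "l \<le> t" using l(2)[of 0] by simp
    ultimately have "l = e"
      using strict[OF e0, of l] fl fe t by force
    with l have "(\<lambda>j. (f ^^ j) t) \<longlonglongrightarrow> e" by simp
    then show ?thesis
      by (rule tendsto_sandwich[OF _ _ e(1), rotated 2])
         (use it_mono[of 0 s] it_mono[of s t] s t in auto)
  qed
  then show ?thesis using e0 e1 s1 unfolding f_def[abs_def] by (intro exI[of _ e] conjI) auto
qed

section \<open>The walk along one line of descent\<close>

primrec walk_pmf :: "int pmf \<Rightarrow> nat \<Rightarrow> int pmf" where
  "walk_pmf a 0 = return_pmf 0"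
| "walk_pmf a (Suc k) = bind_pmf (walk_pmf a k) (\<lambda>s. map_pmf ((+) s) a)"

lemma walk_pmf_Suc': "walk_pmf a (Suc k) = bind_pmf a (\<lambda>j. map_pmf ((+) j) (walk_pmf a k))"
  unfolding walk_pmf.simps map_pmf_def by (subst bind_commute_pmf) (simp add: add.commute)

text \<open>The mean operator is a constant times the transition operator of the walk, so growth and
  displacement separate.\<close>

lemma funpow_walk_pmf:
  fixes h :: "int \<Rightarrow> ennreal" and a :: "int pmf"
  shows "((\<lambda>h x. c * (\<integral>\<^sup>+j. h (x + j) \<partial>a)) ^^ k) h x = c ^ k * (\<integral>\<^sup>+s. h (x + s) \<partial>walk_pmf a k)"
proof (induction k arbitrary: x)
  case (Suc k)
  have "((\<lambda>h x. c * (\<integral>\<^sup>+j. h (x + j) \<partial>a)) ^^ Suc k) h x =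
      c * (\<integral>\<^sup>+j. c ^ k * (\<integral>\<^sup>+s. h (x + j + s) \<partial>walk_pmf a k) \<partial>a)"
    by (simp add: Suc.IH)
  also have "\<dots> = c ^ Suc k * (\<integral>\<^sup>+s. h (x + s) \<partial>walk_pmf a (Suc k))"
    unfolding walk_pmf_Suc' by (simp add: nn_integral_cmult mult.assoc add.assoc)
  finally show ?case .
qed simp

lemma measurable_walk:
  "(\<lambda>\<omega>. \<Sum>i<k. fst (\<omega> (0, i))) \<in> reproduction_space a p \<rightarrow>\<^sub>M count_space UNIV"
proof (induction k)
  case (Suc k)
  show ?case
    unfolding sum.lessThan_Suc
    by (rule measurable_compose_countable[where f = "\<lambda>s \<omega>. s + fst (\<omega> (0, k))", OF _ Suc])
       (rule measurable_compose[OF measurable_reproduction], simp)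
qed simp

text \<open>Row 0 of the reproduction family provides independent jumps, hence a realization of the
  walk as a sum of independent variables on one space, as the central limit theorem
  requires.\<close>

lemma distr_walk:
  "distr (reproduction_space a p) (count_space UNIV) (\<lambda>\<omega>. \<Sum>i<k. fst (\<omega> (0, i))) = measure_pmf (walk_pmf a k)"
proof (induction k)
  case 0
  interpret prob_space "reproduction_space a p" by (rule prob_space_reproduction_space)
  show ?case by (simp add: return_pmf.rep_eq)
next
  case (Suc k)
  have "distr (reproduction_space a p) (count_space UNIV) (\<lambda>\<omega>. fst (\<omega> (0, k))) = measure_pmf a"
  proof -
    have "distr (distr (reproduction_space a p) (measure_pmf (pair_pmf a p)) (\<lambda>\<omega>. \<omega> (0, k))) (count_space UNIV) fst
        = measure_pmf (map_pmf fst (pair_pmf a p))"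
      by (simp add: distr_reproduction map_pmf_rep_eq)
    then show ?thesis
      by (subst (asm) distr_distr) (simp_all add: o_def map_fst_pair_pmf)
  qed
  then have "distr (reproduction_space a p) (count_space UNIV)
      (\<lambda>\<omega>. (\<lambda>s j. s + j) (\<Sum>i<k. fst (\<omega> (0, i))) (fst (\<omega> (0, k))))
    = measure_pmf (bind_pmf (walk_pmf a k) (\<lambda>s. map_pmf (\<lambda>j. s + j) a))"
    by (intro distr_reproduction_space_bind[where A = "{0} \<times> {..<k}" and B = "{(0, k)}" and g = "\<lambda>_ \<omega>. fst (\<omega> (0, k))"]
          measurable_walk Suc.IH measurable_compose[OF measurable_reproduction]) auto
  then show ?case by simp
qed

lemma walk_central_limit:
  fixes y :: real
  assumes r: "\<And>j. j \<in> set_pmf a \<Longrightarrow> \<bar>j\<bar> \<le> r"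
    and mean: "measure_pmf.expectation a real_of_int = 0"
    and var: "measure_pmf.variance a real_of_int > 0"
  shows "(\<lambda>k. measure (walk_pmf a k) {s. y * sqrt (real k * measure_pmf.variance a real_of_int) < real_of_int s})
    \<longlonglongrightarrow> measure std_normal_distribution {y<..}"
proof -
  let ?v = "measure_pmf.variance a real_of_int"
  define \<sigma> where "\<sigma> = sqrt ?v"
  have \<sigma>: "\<sigma> > 0" "\<sigma>\<^sup>2 = ?v" using var by (auto simp: \<sigma>_def)
  \<comment> \<open>Only jumps are read here, so any offspring law can serve; the constant 0 is
    taken.\<close>
  let ?\<Omega> = "reproduction_space a (return_pmf 0)"
  interpret prob_space ?\<Omega> by (rule prob_space_reproduction_space)
  define X :: "nat \<Rightarrow> (nat \<times> nat \<Rightarrow> int \<times> nat) \<Rightarrow> real" where "X i \<omega> = real_of_int (fst (\<omega> (0, i)))" for i \<omega>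
  have Xm: "X i \<in> borel_measurable ?\<Omega>" for i
    unfolding X_def[abs_def] by (rule measurable_compose[OF measurable_reproduction]) simp
  have EX: "integral\<^sup>L ?\<Omega> (\<lambda>\<omega>. \<phi> (fst (\<omega> (0, i)))) = measure_pmf.expectation a \<phi>" for \<phi> :: "int \<Rightarrow> real" and i
  proof -
    have "integral\<^sup>L ?\<Omega> (\<lambda>\<omega>. \<phi> (fst (\<omega> (0, i)))) =
        integral\<^sup>L (distr ?\<Omega> (measure_pmf (pair_pmf a (return_pmf 0))) (\<lambda>\<omega>. \<omega> (0, i))) (\<lambda>jb. \<phi> (fst jb))"
      by (subst integral_distr) simp_all
    also have "\<dots> = measure_pmf.expectation (map_pmf fst (pair_pmf a (return_pmf 0))) \<phi>"
      unfolding distr_reproduction by simp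
    finally show ?thesis by (simp add: map_fst_pair_pmf)
  qed
  have "indep_vars (\<lambda>_. borel) X UNIV"
  proof -
    \<comment> \<open>Singleton blocks \<open>{(0, i)}\<close> turn independence indexed by pairs
      into independence indexed by \<open>i\<close>.\<close>
    have "indep_vars (\<lambda>i::nat. \<Pi>\<^sub>M j\<in>{(0, i)}. measure_pmf (pair_pmf a (return_pmf 0)))
        (\<lambda>i \<omega>. restrict (\<lambda>j. \<omega> j) {(0, i)}) UNIV"
      by (rule indep_vars_restrict[OF indep_vars_reproduction_space]) (auto simp: disjoint_family_on_def)
    then have "indep_vars (\<lambda>_. borel) (\<lambda>i \<omega>. real_of_int (fst (restrict (\<lambda>j. \<omega> j) {(0, i)} (0, i)))) UNIV"
    proof (rule indep_vars_compose2)
      fix i :: nat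
      have "(\<lambda>x. x (0, i)) \<in> (\<Pi>\<^sub>M j\<in>{(0, i)}. measure_pmf (pair_pmf a (return_pmf 0))) \<rightarrow>\<^sub>M measure_pmf (pair_pmf a (return_pmf 0))"
        by (rule measurable_component_singleton) simp
      then show "(\<lambda>x. real_of_int (fst (x (0, i)))) \<in> borel_measurable (\<Pi>\<^sub>M j\<in>{(0, i)}. measure_pmf (pair_pmf a (return_pmf 0)))"
        by (rule measurable_compose) simp
    qed
    then show ?thesis by (simp add: X_def[abs_def])
  qed
  moreover have "expectation (X i) = 0" for i
    unfolding X_def[abs_def] using EX[of real_of_int] mean by simp
  moreover have "integrable ?\<Omega> (\<lambda>\<omega>. (X i \<omega>)\<^sup>2)" for i
  proof -
    have "integrable (distr ?\<Omega> (measure_pmf (pair_pmf a (return_pmf 0))) (\<lambda>\<omega>. \<omega> (0, i))) (\<lambda>jb. (real_of_int (fst jb))\<^sup>2)"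
      unfolding distr_reproduction
    proof (rule measure_pmf.integrable_const_bound[where B = "(real_of_int r)\<^sup>2"])
      show "AE x in pair_pmf a (return_pmf 0). norm ((real_of_int (fst x))\<^sup>2) \<le> (real_of_int r)\<^sup>2"
        using r by (intro AE_pmfI) (fastforce simp flip: of_int_power intro: power2_le_iff_abs_le[THEN iffD2])
    qed simp
    then show ?thesis
      by (subst (asm) integrable_distr_eq) (simp_all add: X_def)
  qed
  moreover have "variance (X i) = \<sigma>\<^sup>2" for i
    using EX[of "\<lambda>j. (real_of_int j - measure_pmf.expectation a real_of_int)\<^sup>2" i] EX[of real_of_int i] \<sigma>
    by (simp add: X_def[abs_def])
  moreover have "distr ?\<Omega> borel (X i) = distr (pair_pmf a (return_pmf (0 :: nat))) borel (\<lambda>jb. real_of_int (fst jb))" for i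
  proof -
    have "distr (distr ?\<Omega> (measure_pmf (pair_pmf a (return_pmf 0))) (\<lambda>\<omega>. \<omega> (0, i))) borel (\<lambda>jb. real_of_int (fst jb))
       = distr ?\<Omega> borel (X i)"
      by (subst distr_distr) (simp_all add: o_def X_def[abs_def])
    then show ?thesis unfolding distr_reproduction by (rule sym)
  qed
  ultimately have "weak_conv_m (\<lambda>k. distr ?\<Omega> borel (\<lambda>\<omega>. (\<Sum>i<k. X i \<omega>) / sqrt (real k * \<sigma>\<^sup>2))) std_normal_distribution"
    using \<sigma>(1) by (intro central_limit_theorem_zero_mean[where \<sigma> = \<sigma>])
  \<comment> \<open>Weak convergence yields convergence of the distribution functions at continuity
    points only; the normal law has no atom at \<open>y\<close>.\<close>
  moreover have "isCont (cdf std_normal_distribution) y"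
  proof -
    interpret N: real_distribution std_normal_distribution by (rule real_dist_normal_dist)
    have "emeasure std_normal_distribution {y} = 0"
      by (subst emeasure_density) (auto simp: nn_integral_cmult_indicator)
    then show ?thesis by (simp add: N.isCont_cdf measure_def)
  qed
  ultimately have lim: "(\<lambda>k. cdf (distr ?\<Omega> borel (\<lambda>\<omega>. (\<Sum>i<k. X i \<omega>) / sqrt (real k * \<sigma>\<^sup>2))) y) \<longlonglongrightarrow> cdf std_normal_distribution y"
    unfolding weak_conv_m_def weak_conv_def by blast
  have compl: "1 - cdf M y = measure M {y<..}" if "real_distribution M" for M
  proof -
    interpret M: real_distribution M by fact
    have "- {..y} = {y<..}" by auto
    then show ?thesis using M.prob_compl[of "{..y}"] by (simp add: cdf_def Compl_eq_Diff_UNIV)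
  qed
  have Sm: "(\<lambda>\<omega>. (\<Sum>i<k. X i \<omega>) / sqrt (real k * \<sigma>\<^sup>2)) \<in> borel_measurable ?\<Omega>" for k
    using Xm by measurable
  have "(\<lambda>k. 1 - cdf (distr ?\<Omega> borel (\<lambda>\<omega>. (\<Sum>i<k. X i \<omega>) / sqrt (real k * \<sigma>\<^sup>2))) y) \<longlonglongrightarrow> 1 - cdf std_normal_distribution y"
    by (intro tendsto_intros lim)
  then have "(\<lambda>k. measure (distr ?\<Omega> borel (\<lambda>\<omega>. (\<Sum>i<k. X i \<omega>) / sqrt (real k * \<sigma>\<^sup>2))) {y<..}) \<longlonglongrightarrow> measure std_normal_distribution {y<..}"
    by (simp add: compl real_dist_normal_dist real_distribution_distr Sm)
  then show ?thesis
  proof (rule Lim_transform_eventually)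
    show "\<forall>\<^sub>F k in sequentially. measure (distr ?\<Omega> borel (\<lambda>\<omega>. (\<Sum>i<k. X i \<omega>) / sqrt (real k * \<sigma>\<^sup>2))) {y<..} =
      measure (walk_pmf a k) {s. y * sqrt (real k * ?v) < real_of_int s}"
      using eventually_gt_at_top[of 0]
    proof eventually_elim
      case (elim k)
      have pos: "0 < sqrt (real k * ?v)" using elim var by simp
      have "measure (walk_pmf a k) {s. y * sqrt (real k * ?v) < real_of_int s} =
        measure ?\<Omega> {\<omega>. y * sqrt (real k * ?v) < real_of_int (\<Sum>i<k. fst (\<omega> (0, i)))}"
        unfolding distr_walk[of a "return_pmf 0", symmetric] by (subst measure_distr[OF measurable_walk]) (auto simp: vimage_def)
      also have "\<dots> = measure ?\<Omega> ((\<lambda>\<omega>. (\<Sum>i<k. X i \<omega>) / sqrt (real k * \<sigma>\<^sup>2)) -` {y<..} \<inter> space ?\<Omega>)"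
        using pos by (simp add: X_def \<sigma>(2) vimage_def pos_less_divide_eq)
      also have "\<dots> = measure (distr ?\<Omega> borel (\<lambda>\<omega>. (\<Sum>i<k. X i \<omega>) / sqrt (real k * \<sigma>\<^sup>2))) {y<..}"
        by (rule measure_distr[OF Sm, symmetric]) simp
      finally show ?case by simp
    qed
  qed
qed

text \<open>On the unit interval to the right of \<open>y\<close> the density is at least its value
  at the right end. This is crude but has the correct leading exponent, which is all that
  \<open>supercritical_block\<close> uses.\<close>

lemma std_normal_tail_lower:
  assumes "0 \<le> y"
  shows "exp (- (y + 1)\<^sup>2 / 2) / sqrt (2 * pi) \<le> measure std_normal_distribution {y<..}"
proof -
  interpret N: real_distribution std_normal_distribution by (rule real_dist_normal_dist)
  let ?d = "exp (- (y + 1)\<^sup>2 / 2) / sqrt (2 * pi)"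
  have "ennreal ?d = (\<integral>\<^sup>+x. ennreal ?d * indicator {y<..y+1} x \<partial>lborel)"
    by (simp add: nn_integral_cmult_indicator)
  also have "\<dots> \<le> (\<integral>\<^sup>+x. ennreal (std_normal_density x) * indicator {y<..} x \<partial>lborel)"
  proof (rule nn_integral_mono)
    fix x :: real
    have "?d \<le> std_normal_density x" if "y < x" "x \<le> y + 1"
      unfolding std_normal_density_def using that assms
      by (auto intro!: divide_right_mono power_mono simp: divide_simps)
    then show "ennreal ?d * indicator {y<..y+1} x \<le> ennreal (std_normal_density x) * indicator {y<..} x"
      by (auto simp: indicator_def intro!: ennreal_leI)
  qed
  also have "\<dots> = emeasure std_normal_distribution {y<..}"
    by (subst emeasure_density) auto
  finally show ?thesis by (simp add: N.emeasure_eq_measure)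
qed

section \<open>Growth against displacement in the two regimes\<close>

text \<open>Take \<open>L = n * T\<close>. As \<open>n\<close> grows, the population mean tends to
  \<open>exp (\<theta> * T)\<close> and the walk probability to a normal tail of order
  \<open>exp (- \<beta>^2 * T / 2)\<close>, up to lower-order terms in the exponent. Since
  \<open>\<beta>^2 < 2 * \<theta>\<close>, a large fixed \<open>T\<close> makes the product exceed
  1; only then is \<open>n\<close> sent to infinity.\<close>

lemma supercritical_block:
  assumes r: "\<And>j. j \<in> set_pmf a \<Longrightarrow> \<bar>j\<bar> \<le> r"
    and mean: "measure_pmf.expectation a real_of_int = 0"
    and var: "measure_pmf.variance a real_of_int > 0"
    and \<theta>: "0 < \<theta>" and w: "0 < w" "w < sqrt (2 * \<theta> * measure_pmf.variance a real_of_int)"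
  shows "\<forall>\<^sub>F n in sequentially. \<exists>L V. 0 < L \<and> w * real L \<le> sqrt (real n) * real_of_int V \<and>
    1 < (1 + \<theta> / real n) ^ L * measure (walk_pmf a L) {s. V \<le> s}"
proof -
  let ?v = "measure_pmf.variance a real_of_int"
  \<comment> \<open>The slack between \<open>w\<close> and \<open>u\<close> later absorbs the
    rounding of \<open>V\<close> to an integer.\<close>
  obtain u where u: "w < u" "u < sqrt (2 * \<theta> * ?v)" using dense[OF w(2)] by auto
  define \<beta> where "\<beta> = u / sqrt ?v"
  have sv: "sqrt ?v > 0" using var by simp
  have \<beta>: "0 < \<beta>" "\<beta>\<^sup>2 < 2 * \<theta>"
  proof -
    show "0 < \<beta>" using u w sv by (simp add: \<beta>_def)
    have "u\<^sup>2 < (sqrt (2 * \<theta> * ?v))\<^sup>2" using u w by (intro power_strict_mono) auto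
    then have "u\<^sup>2 < 2 * \<theta> * ?v" using \<theta> var by simp
    then show "\<beta>\<^sup>2 < 2 * \<theta>" using var by (simp add: \<beta>_def power_divide pos_divide_less_eq)
  qed
  have "\<forall>\<^sub>F T::nat in sequentially. 1 < exp (\<theta> * real T) * (exp (- (\<beta> * sqrt (real T) + 1)\<^sup>2 / 2) / sqrt (2 * pi))"
  proof -
    \<comment> \<open>\<kappa> is the net exponential rate in \<open>T\<close>; the corrections are
      only of order \<open>sqrt T\<close>.\<close>
    define \<kappa> where "\<kappa> = \<theta> - \<beta>\<^sup>2 / 2"
    have \<kappa>: "\<kappa> > 0" using \<beta> by (simp add: \<kappa>_def)
    have eq: "exp (\<theta> * real T) * (exp (- (\<beta> * sqrt (real T) + 1)\<^sup>2 / 2) / sqrt (2 * pi))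
        = exp (\<kappa> * real T - \<beta> * sqrt (real T) - 1 / 2) / sqrt (2 * pi)" for T
      by (simp add: mult_exp_exp power2_sum power_mult_distrib \<kappa>_def field_simps)
    have "filterlim (\<lambda>T::nat. exp (\<kappa> * real T - \<beta> * sqrt (real T) - 1 / 2) / sqrt (2 * pi)) at_top sequentially"
      using \<kappa> \<beta>(1) by real_asymp
    then show ?thesis unfolding eq filterlim_at_top_dense by blast
  qed
  with eventually_gt_at_top[of 0] have "\<forall>\<^sub>F T::nat in sequentially.
      0 < T \<and> 1 < exp (\<theta> * real T) * (exp (- (\<beta> * sqrt (real T) + 1)\<^sup>2 / 2) / sqrt (2 * pi))"
    by eventually_elim auto
  then obtain T :: nat where T: "0 < T" "1 < exp (\<theta> * real T) * (exp (- (\<beta> * sqrt (real T) + 1)\<^sup>2 / 2) / sqrt (2 * pi))"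
    by (auto dest: eventually_happens)
  define y where "y = \<beta> * sqrt (real T)"
  have "exp (\<theta> * real T) * (exp (- (y + 1)\<^sup>2 / 2) / sqrt (2 * pi)) \<le> exp (\<theta> * real T) * measure std_normal_distribution {y<..}"
    using \<beta> by (intro mult_left_mono std_normal_tail_lower) (auto simp: y_def)
  with T(2) have "1 < exp (\<theta> * real T) * measure std_normal_distribution {y<..}"
    unfolding y_def by (rule less_le_trans)
  moreover have "(\<lambda>n. ((1 + \<theta> / real n) ^ n) ^ T * measure (walk_pmf a (n * T)) {s. y * sqrt (real (n * T) * ?v) < real_of_int s})
      \<longlonglongrightarrow> exp \<theta> ^ T * measure std_normal_distribution {y<..}"
  proof (intro tendsto_intros tendsto_exp_limit_sequentially)
    have "strict_mono (\<lambda>n. n * T)" using T by (auto simp: strict_mono_def)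
    from LIMSEQ_subseq_LIMSEQ[OF walk_central_limit[OF r mean var, of y] this]
    show "(\<lambda>n. measure (walk_pmf a (n * T)) {s. y * sqrt (real (n * T) * ?v) < real_of_int s})
      \<longlonglongrightarrow> measure std_normal_distribution {y<..}" by (simp add: o_def)
  qed
  ultimately have "\<forall>\<^sub>F n in sequentially.
      1 < ((1 + \<theta> / real n) ^ n) ^ T * measure (walk_pmf a (n * T)) {s. y * sqrt (real (n * T) * ?v) < real_of_int s}"
    unfolding exp_of_nat2_mult by (intro order_tendstoD(1))
  moreover have "\<forall>\<^sub>F n::nat in sequentially. w * sqrt (real n) * real T + 1 \<le> u * sqrt (real n) * real T"
  proof -
    have "filterlim (\<lambda>n::nat. (u - w) * real T * sqrt (real n)) at_top sequentially"
      using u T by real_asymp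
    then show ?thesis
      unfolding filterlim_at_top by (elim allE[of _ 1] eventually_mono) (simp add: algebra_simps)
  qed
  ultimately show ?thesis
    using eventually_gt_at_top[of 0]
  proof eventually_elim
    case (elim n)
    define V where "V = \<lceil>w * sqrt (real n) * real T\<rceil>"
    have sq: "sqrt (real n) * sqrt (real n) = real n" by simp
    have "w * real (n * T) = sqrt (real n) * (w * sqrt (real n) * real T)"
      using sq by (simp add: algebra_simps)
    also have "\<dots> \<le> sqrt (real n) * real_of_int V" by (intro mult_left_mono) (auto simp: V_def)
    finally have 1: "w * real (n * T) \<le> sqrt (real n) * real_of_int V" .
    have y: "y * sqrt (real (n * T) * ?v) = u * sqrt (real n) * real T"
      using sv by (simp add: y_def \<beta>_def real_sqrt_mult field_simps)
    have "real_of_int V \<le> y * sqrt (real (n * T) * ?v)"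
      unfolding y using elim(2) by (simp add: V_def) linarith
    then have "measure (walk_pmf a (n * T)) {s. y * sqrt (real (n * T) * ?v) < real_of_int s} \<le> measure (walk_pmf a (n * T)) {s. V \<le> s}"
      by (intro measure_pmf.finite_measure_mono) auto
    then have "((1 + \<theta> / real n) ^ n) ^ T * measure (walk_pmf a (n * T)) {s. y * sqrt (real (n * T) * ?v) < real_of_int s}
        \<le> ((1 + \<theta> / real n) ^ n) ^ T * measure (walk_pmf a (n * T)) {s. V \<le> s}"
      using \<theta> by (intro mult_left_mono) auto
    with elim(1) have "1 < (1 + \<theta> / real n) ^ (n * T) * measure (walk_pmf a (n * T)) {s. V \<le> s}"
      by (simp add: power_mult)
    with 1 T elim(3) show ?case by (intro exI[of _ "n * T"] exI[of _ V]) simp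
  qed
qed

text \<open>With tilt \<open>c / sqrt n\<close> and jump variance \<open>v\<close>, the logarithm of
  the product is at most \<open>(\<theta> + v * c^2 / 2 - c / \<gamma>) / n\<close>, apart from a
  factor tending to 1 in the middle term. It suffices that the bracket is negative for some
  \<open>c\<close>.\<close>

lemma subcritical_tilt:
  assumes r: "\<And>j. j \<in> set_pmf a \<Longrightarrow> \<bar>j\<bar> \<le> r"
    and mean: "measure_pmf.expectation a real_of_int = 0"
    and var: "measure_pmf.variance a real_of_int > 0"
    and \<theta>: "0 < \<theta>" and \<gamma>: "0 < \<gamma>" "2 * \<theta> * measure_pmf.variance a real_of_int * \<gamma>\<^sup>2 < 1"
  shows "\<exists>c>0. \<forall>\<^sub>F n in sequentially. (1 + \<theta> / real n) *
    measure_pmf.expectation a (\<lambda>j. exp (c / sqrt (real n) * real_of_int j)) * exp (- (c / sqrt (real n)) / (\<gamma> * sqrt (real n))) < 1"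
proof -
  let ?v = "measure_pmf.variance a real_of_int"
  \<comment> \<open>This \<open>c\<close> minimizes
    \<open>\<theta> + v * c^2 / 2 - c / \<gamma>\<close>; the minimum
    \<open>\<theta> - 1 / (2 * v * \<gamma>^2)\<close> is negative by the assumption on
    \<gamma>.\<close>
  define c where "c = 1 / (\<gamma> * ?v)"
  have c: "c > 0" using var \<gamma> by (simp add: c_def)
  have r0: "0 \<le> r" using r set_pmf_not_empty[of a] by (metis abs_ge_zero all_not_in_conv order_trans)
  \<comment> \<open>Second-order Taylor expansion, with the remainder controlled by the bounded
    jumps. As the mean is 0, the linear term vanishes and \<open>?v\<close> is the second
    moment.\<close>
  have mgf: "measure_pmf.expectation a (\<lambda>j. exp (l * real_of_int j)) \<le> 1 + ?v * l\<^sup>2 / 2 * exp (l * r)" if "0 \<le> l" for l :: real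
  proof -
    have pt: "exp (l * real_of_int j) \<le> 1 + l * real_of_int j + l\<^sup>2 / 2 * exp (l * r) * (real_of_int j)\<^sup>2"
      if "j \<in> set_pmf a" for j
    proof -
      obtain t where t: "\<bar>t\<bar> \<le> \<bar>l * real_of_int j\<bar>"
        "exp (l * real_of_int j) = (\<Sum>m<2. (l * real_of_int j) ^ m / fact m) + exp t / fact 2 * (l * real_of_int j) ^ 2"
        using Maclaurin_exp_le[of "l * real_of_int j" 2] by auto
      have "\<bar>l * real_of_int j\<bar> \<le> l * r" using r[OF \<open>j \<in> set_pmf a\<close>] \<open>0 \<le> l\<close>
        by (simp add: abs_mult mult_left_mono flip: of_int_abs)
      with t(1) have "exp t \<le> exp (l * r)" by simp
      then have "exp t / fact 2 * (l * real_of_int j) ^ 2 \<le> exp (l * r) / 2 * (l * real_of_int j) ^ 2"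
        by (intro mult_right_mono) auto
      with t(2) show ?thesis by (simp add: numeral_2_eq_2 power_mult_distrib field_simps)
    qed
    have bdd: "integrable a \<phi>" if "\<And>j. j \<in> set_pmf a \<Longrightarrow> \<bar>\<phi> j\<bar> \<le> C" for \<phi> :: "int \<Rightarrow> real" and C
      using that by (intro measure_pmf.integrable_const_bound[where B = C] AE_pmfI) auto
    have i1: "integrable a real_of_int"
      using r by (intro bdd[of _ "real_of_int r"]) (simp flip: of_int_abs)
    have i2: "integrable a (\<lambda>j. (real_of_int j)\<^sup>2)"
      using r by (intro bdd[of _ "(real_of_int r)\<^sup>2"]) (fastforce simp flip: of_int_power intro: power2_le_iff_abs_le[THEN iffD2])
    have i3: "integrable a (\<lambda>j. exp (l * real_of_int j))"
      using r \<open>0 \<le> l\<close> by (intro bdd[of _ "exp (l * real_of_int r)"]) (auto intro!: mult_left_mono dest!: r)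
    have "measure_pmf.expectation a (\<lambda>j. exp (l * real_of_int j)) \<le>
        measure_pmf.expectation a (\<lambda>j. 1 + l * real_of_int j + l\<^sup>2 / 2 * exp (l * r) * (real_of_int j)\<^sup>2)"
      using i1 i2 i3 pt by (intro integral_mono_AE AE_pmfI) auto
    also have "\<dots> = 1 + ?v * l\<^sup>2 / 2 * exp (l * r)"
      using i1 i2 mean by simp
    finally show ?thesis .
  qed
  have "\<theta> + ?v * c\<^sup>2 / 2 * 1 - c / \<gamma> < 0"
  proof -
    have "\<theta> + ?v * c\<^sup>2 / 2 * 1 - c / \<gamma> = (2 * \<theta> * ?v * \<gamma>\<^sup>2 - 1) / (2 * ?v * \<gamma>\<^sup>2)"
      using var \<gamma>(1) by (simp add: c_def field_simps power2_eq_square)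
    also have "\<dots> < 0" using \<gamma> var by (simp add: divide_neg_pos)
    finally show ?thesis .
  qed
  moreover have "(\<lambda>n::nat. \<theta> + ?v * c\<^sup>2 / 2 * exp (c / sqrt (real n) * r) - c / \<gamma>) \<longlonglongrightarrow> \<theta> + ?v * c\<^sup>2 / 2 * 1 - c / \<gamma>"
  proof (intro tendsto_intros)
    show "(\<lambda>n::nat. exp (c / sqrt (real n) * r)) \<longlonglongrightarrow> 1" by real_asymp
  qed
  ultimately have "\<forall>\<^sub>F n::nat in sequentially. \<theta> + ?v * c\<^sup>2 / 2 * exp (c / sqrt (real n) * r) - c / \<gamma> < 0"
    by (intro order_tendstoD(2))
  then have "\<forall>\<^sub>F n in sequentially. (1 + \<theta> / real n) *
    measure_pmf.expectation a (\<lambda>j. exp (c / sqrt (real n) * real_of_int j)) * exp (- (c / sqrt (real n)) / (\<gamma> * sqrt (real n))) < 1"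
    using eventually_gt_at_top[of 0]
  proof eventually_elim
    case (elim n)
    let ?l = "c / sqrt (real n)"
    have l: "0 \<le> ?l" "?l\<^sup>2 = c\<^sup>2 / real n" using c by (auto simp: power_divide)
    have "measure_pmf.expectation a (\<lambda>j. exp (?l * real_of_int j)) \<le> exp (?v * ?l\<^sup>2 / 2 * exp (?l * r))"
      using mgf[OF l(1)] exp_ge_add_one_self[of "?v * ?l\<^sup>2 / 2 * exp (?l * r)"] by linarith
    then have "(1 + \<theta> / real n) * measure_pmf.expectation a (\<lambda>j. exp (?l * real_of_int j)) * exp (- ?l / (\<gamma> * sqrt (real n)))
      \<le> exp (\<theta> / real n) * exp (?v * ?l\<^sup>2 / 2 * exp (?l * r)) * exp (- ?l / (\<gamma> * sqrt (real n)))"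
      using \<theta> by (intro mult_right_mono mult_mono) (auto intro!: integral_nonneg_AE)
    also have "\<dots> = exp ((\<theta> + ?v * c\<^sup>2 / 2 * exp (c / sqrt (real n) * r) - c / \<gamma>) / real n)"
      using elim \<gamma> by (simp add: mult_exp_exp l(2) field_simps)
    also have "\<dots> < 1" using elim by (simp add: divide_neg_pos)
    finally show ?case .
  qed
  with c show ?thesis by blast
qed

section \<open>The front of the branching random walk\<close>

lemma distr_particles:
  "distr (reproduction_space a p) (count_space UNIV) (\<lambda>\<omega>. particles n \<omega> k) = measure_pmf (brw_iter a p k (replicate n 0))"
proof -
  have "distr (distr (reproduction_space a p) (count_space UNIV) (\<lambda>\<omega>. map (particles n \<omega>) [0..<Suc k])) (count_space UNIV) last
     = measure_pmf (map_pmf last (brw_path a p k (replicate n 0)))"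
    unfolding distr_history by (simp add: map_pmf_rep_eq)
  then show ?thesis
    unfolding map_last_brw_path by (subst (asm) distr_distr[OF _ measurable_history]) (simp_all add: o_def)
qed

lemma sets_particles [simp]:
  "{\<omega>. P (particles n \<omega> k)} \<in> sets (reproduction_space a p)"
  using measurable_sets[OF measurable_particles[of n k a p], of "{xs. P xs}"] by (simp add: vimage_def)

lemma nn_integral_particles:
  "(\<integral>\<^sup>+\<omega>. \<phi> (particles n \<omega> k) \<partial>reproduction_space a p) = (\<integral>\<^sup>+xs. \<phi> xs \<partial>brw_iter a p k (replicate n 0))"
  unfolding distr_particles[symmetric] by (subst nn_integral_distr[OF measurable_particles]) simp_all

lemma emeasure_particles:
  "emeasure (reproduction_space a p) {\<omega>. P (particles n \<omega> k)} = (\<integral>\<^sup>+xs. indicator {xs. P xs} xs \<partial>brw_iter a p k (replicate n 0))"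
proof -
  have "(\<integral>\<^sup>+\<omega>. indicator {xs. P xs} (particles n \<omega> k) \<partial>reproduction_space a p) =
      (\<integral>\<^sup>+\<omega>. indicator {\<omega>. P (particles n \<omega> k)} \<omega> \<partial>reproduction_space a p)"
    by (intro nn_integral_cong) (simp add: indicator_def)
  then show ?thesis by (simp add: nn_integral_particles)
qed

text \<open>The Bochner integral of a non-integrable function is 0, so a positive expectation
  already shows integrability.\<close>

lemma nn_integral_offspring_mean:
  assumes "measure_pmf.expectation p real = m" "0 < m"
  shows "(\<integral>\<^sup>+b. of_nat b \<partial>p) = ennreal m"
proof -
  have "integrable p real"
    using assms not_integrable_integral_eq[of "measure_pmf p" real] by fastforce
  then show ?thesis
    using assms by (simp add: nn_integral_eq_integral ennreal_of_nat_eq_real_of_nat)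
qed

section \<open>Upper bound for the front\<close>

text \<open>First moment bound: a particle beyond \<open>c * k\<close> exists in generation
  \<open>k\<close> with probability at most \<open>n * \<rho> ^ k\<close>. This is summable, so
  almost surely only finitely many generations contain one.\<close>

lemma subcritical_front:
  fixes c l m :: real
  assumes r: "\<And>j. j \<in> set_pmf a \<Longrightarrow> \<bar>j\<bar> \<le> r"
    and mean: "measure_pmf.expectation p real = m" and m: "0 < m" and l: "0 < l"
    and lt: "m * measure_pmf.expectation a (\<lambda>j. exp (l * real_of_int j)) * exp (- l * c) < 1"
  shows "AE \<omega> in reproduction_space a p. \<forall>\<^sub>F k in sequentially. \<forall>x\<in>set (particles n \<omega> k). real_of_int x \<le> c * real k"
proof -
  interpret prob_space "reproduction_space a p" by (rule prob_space_reproduction_space)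
  define \<phi> where "\<phi> = measure_pmf.expectation a (\<lambda>j. exp (l * real_of_int j))"
  define \<rho> where "\<rho> = m * \<phi> * exp (- l * c)"
  have \<phi>0: "0 \<le> \<phi>" unfolding \<phi>_def by (intro integral_nonneg_AE) auto
  have \<rho>: "0 \<le> \<rho>" "\<rho> < 1" using \<phi>0 m lt by (auto simp: \<rho>_def \<phi>_def)
  have int: "integrable a (\<lambda>j. exp (l * real_of_int j))"
  proof (rule measure_pmf.integrable_const_bound[where B = "exp (l * real_of_int r)"])
    show "AE x in a. norm (exp (l * real_of_int x)) \<le> exp (l * real_of_int r)"
      using l by (intro AE_pmfI) (auto dest!: r)
  qed simp
  let ?h = "\<lambda>x::int. ennreal (exp (l * real_of_int x))"
  let ?T = "\<lambda>h x. (\<integral>\<^sup>+b. of_nat b \<partial>p) * (\<integral>\<^sup>+j. h (x + j) \<partial>a)"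
  \<comment> \<open>Exponentials are eigenfunctions of the mean operator, with eigenvalue
    \<open>m * \<phi>\<close>.\<close>
  have T: "?T (\<lambda>x. ennreal d * ?h x) = (\<lambda>x. ennreal (m * \<phi> * d) * ?h x)" if "0 \<le> d" for d :: real
  proof
    fix x
    have "(\<integral>\<^sup>+j. ennreal d * ?h (x + j) \<partial>a) = ennreal d * (ennreal (exp (l * real_of_int x)) * (\<integral>\<^sup>+j. ennreal (exp (l * real_of_int j)) \<partial>a))"
      by (simp add: nn_integral_cmult distrib_left exp_add ennreal_mult)
    also have "(\<integral>\<^sup>+j. ennreal (exp (l * real_of_int j)) \<partial>a) = ennreal \<phi>"
      unfolding \<phi>_def by (intro nn_integral_eq_integral int) auto
    finally show "?T (\<lambda>x. ennreal d * ?h x) x = ennreal (m * \<phi> * d) * ?h x"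
      using nn_integral_offspring_mean[OF mean m] m \<phi>0 that
      by (simp add: ennreal_mult'[symmetric] mult_ac)
  qed
  have Tk: "(?T ^^ k) ?h = (\<lambda>x. ennreal ((m * \<phi>) ^ k) * ?h x)" for k
  proof (induction k)
    case (Suc k)
    then show ?case using T[of "(m * \<phi>) ^ k"] m \<phi>0 by simp
  qed simp
  define A where "A k = {\<omega>. \<exists>x\<in>set (particles n \<omega> k). c * real k < real_of_int x}" for k
  have A: "A k \<in> sets (reproduction_space a p)" for k
    unfolding A_def by (rule sets_particles[where P = "\<lambda>xs. \<exists>x\<in>set xs. c * real k < real_of_int x"])
  have bound: "measure (reproduction_space a p) (A k) \<le> real n * \<rho> ^ k" for k
  proof -
    have "emeasure (reproduction_space a p) (A k) = (\<integral>\<^sup>+xs. indicator {xs. \<exists>x\<in>set xs. c * real k < real_of_int x} xs \<partial>brw_iter a p k (replicate n 0))"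
      unfolding A_def by (rule emeasure_particles)
    \<comment> \<open>Markov's inequality: a single particle beyond the line makes the tilted sum at
      least 1.\<close>
    also have "\<dots> \<le> (\<integral>\<^sup>+xs. ennreal (exp (- l * (c * real k))) * sum_list (map ?h xs) \<partial>brw_iter a p k (replicate n 0))"
    proof (intro nn_integral_mono)
      fix xs :: "int list"
      have "1 \<le> ennreal (exp (- l * (c * real k))) * sum_list (map ?h xs)"
        if "x \<in> set xs" "c * real k < real_of_int x" for x
      proof -
        have "1 \<le> ennreal (exp (- l * (c * real k))) * ?h x"
          using that(2) l by (simp add: ennreal_mult'[symmetric] mult_exp_exp)
        also have "\<dots> \<le> ennreal (exp (- l * (c * real k))) * sum_list (map ?h xs)"
          using that(1) by (intro mult_left_mono member_le_sum_list) auto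
        finally show ?thesis .
      qed
      then show "indicator {xs. \<exists>x\<in>set xs. c * real k < real_of_int x} xs \<le> ennreal (exp (- l * (c * real k))) * sum_list (map ?h xs)"
        by (auto simp: indicator_def)
    qed
    also have "\<dots> = ennreal (exp (- l * (c * real k))) * (of_nat n * ennreal ((m * \<phi>) ^ k))"
      by (simp add: nn_integral_cmult nn_integral_brw_iter_sum_list Tk sum_list_replicate del: sum_list_ennreal)
    also have "\<dots> = ennreal (exp (- l * (c * real k)) * (real n * (m * \<phi>) ^ k))"
      using m \<phi>0 by (simp add: ennreal_mult ennreal_of_nat_eq_real_of_nat)
    also have "exp (- l * (c * real k)) * (real n * (m * \<phi>) ^ k) = real n * \<rho> ^ k"
    proof -
      have "exp (- l * (c * real k)) = exp (- l * c) ^ k" by (simp add: exp_of_nat2_mult[symmetric] mult.assoc)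
      then show ?thesis by (simp add: \<rho>_def power_mult_distrib)
    qed
    finally show ?thesis using \<rho> by (simp add: emeasure_eq_measure)
  qed
  have "summable (\<lambda>k. measure (reproduction_space a p) (A k))"
    by (rule summable_comparison_test'[where N = 0 and g = "\<lambda>k. real n * \<rho> ^ k"])
       (use \<rho> bound in \<open>auto intro: summable_mult summable_geometric\<close>)
  then have "AE \<omega> in reproduction_space a p. \<forall>\<^sub>F k in sequentially. \<omega> \<in> space (reproduction_space a p) - A k"
    by (intro borel_cantelli_AE1 A) (simp_all add: emeasure_eq_measure)
  then show ?thesis
    by eventually_elim (auto simp: A_def not_less elim!: eventually_mono)
qed

text \<open>In late generations \<open>k \<le> n * \<gamma> * t\<close> the front bound
  \<open>k / (\<gamma> * sqrt n)\<close> is at most \<open>sqrt n * t\<close>. The finitely many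
  particles of earlier generations do not exceed a fixed \<open>M\<close>, which
  \<open>sqrt n * t\<close> overtakes.\<close>

lemma eventually_no_particles_beyond:
  assumes front: "\<forall>\<^sub>F k in sequentially. \<forall>x\<in>set (particles n \<omega> k). real_of_int x \<le> 1 / (\<gamma> * sqrt (real n)) * real k"
    and \<gamma>: "0 < \<gamma>" and n: "0 < n"
  shows "\<forall>\<^sub>F t in at_top. total_on_set (occupation (particle_counts n \<omega>) (nat \<lfloor>real n * \<gamma> * t\<rfloor>)) {sqrt (real n) * t<..} = 0"
proof -
  obtain K where K: "\<And>k x. K \<le> k \<Longrightarrow> x \<in> set (particles n \<omega> k) \<Longrightarrow> real_of_int x \<le> 1 / (\<gamma> * sqrt (real n)) * real k"
    using front unfolding eventually_sequentially by blast
  \<comment> \<open>\<open>insert 0\<close> keeps the maximum meaningful when there are no early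
    particles.\<close>
  define M where "M = Max (insert 0 (\<Union>k<K. set (particles n \<omega> k)))"
  have M: "x \<le> M" if "k < K" "x \<in> set (particles n \<omega> k)" for k x
    unfolding M_def using that by (intro Max_ge) auto
  have sq: "sqrt (real n) > 0" using n by simp
  show ?thesis
    using eventually_ge_at_top[of 0] eventually_ge_at_top[of "real_of_int M / sqrt (real n)"]
  proof eventually_elim
    case (elim t)
    have "particle_counts n \<omega> k x = 0" if x: "sqrt (real n) * t < real_of_int x" and k: "k \<le> nat \<lfloor>real n * \<gamma> * t\<rfloor>" for x k
    proof -
      have "x \<notin> set (particles n \<omega> k)"
      proof
        assume mem: "x \<in> set (particles n \<omega> k)"
        show False
        proof (cases "k < K")
          case True
          have "real_of_int M \<le> sqrt (real n) * t" using elim(2) sq by (simp add: field_simps)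
          with M[OF True mem] x show False by linarith
        next
          case False
          have "0 \<le> real n * \<gamma> * t" using elim(1) \<gamma> by simp
          then have "real k \<le> real n * \<gamma> * t" using k by linarith
          then have "1 / (\<gamma> * sqrt (real n)) * real k \<le> 1 / (\<gamma> * sqrt (real n)) * (real n * \<gamma> * t)"
            using \<gamma> by (intro mult_left_mono) auto
          also have "\<dots> = sqrt (real n) * t"
            using \<gamma> sq by (simp add: field_simps)
          finally show False using K[of k x] False mem x by simp
        qed
      qed
      then show ?thesis by (simp add: particle_counts_def count_list_0_iff)
    qed
    then show ?case by (simp add: total_on_set_eq_0_iff occupation_def)
  qed
qed

section \<open>Survival and lower bound for the front\<close>

text \<open>The jump bound holds only almost surely, because \<open>reproduction_space\<close>
  contains all families of pairs; it is read off from the support of the history law.\<close>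

lemma AE_steps:
  assumes r: "\<And>j. j \<in> set_pmf a \<Longrightarrow> \<bar>j\<bar> \<le> r"
  shows "AE \<omega> in reproduction_space a p. \<forall>k. \<forall>y\<in>set (particles n \<omega> (Suc k)). \<exists>x\<in>set (particles n \<omega> k). \<bar>y - x\<bar> \<le> r"
proof (subst AE_all_countable, intro allI)
  fix k
  have "AE h in distr (reproduction_space a p) (count_space UNIV) (\<lambda>\<omega>. map (particles n \<omega>) [0..<Suc (Suc k)]).
      \<forall>y\<in>set (h ! Suc k). \<exists>x\<in>set (h ! k). \<bar>y - x\<bar> \<le> r"
    unfolding distr_history
  proof (rule AE_pmfI, intro ballI)
    fix h y assume h: "h \<in> set_pmf (brw_path a p (Suc k) (replicate n 0))" and y: "y \<in> set (h ! Suc k)"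
    have "h ! Suc k \<in> set_pmf (brw_step a p (h ! k))" using set_brw_path[OF h] by simp
    from set_brw_step[OF this y] obtain x j where "x \<in> set (h ! k)" "j \<in> set_pmf a" "y = x + j" by blast
    with r[of j] show "\<exists>x\<in>set (h ! k). \<bar>y - x\<bar> \<le> r" by (intro bexI[of _ x]) auto
  qed
  then have "AE \<omega> in reproduction_space a p. \<forall>y\<in>set (map (particles n \<omega>) [0..<Suc (Suc k)] ! Suc k).
      \<exists>x\<in>set (map (particles n \<omega>) [0..<Suc (Suc k)] ! k). \<bar>y - x\<bar> \<le> r"
    by (subst (asm) AE_distr_iff[OF measurable_history]) simp_all
  then show "AE \<omega> in reproduction_space a p. \<forall>y\<in>set (particles n \<omega> (Suc k)). \<exists>x\<in>set (particles n \<omega> k). \<bar>y - x\<bar> \<le> r"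
    by eventually_elim (simp add: nth_append del: upt_Suc)
qed

lemma nn_integral_power_length_brw_iter:
  assumes "0 \<le> s" "s \<le> 1"
  shows "(\<integral>\<^sup>+xs. ennreal s ^ length xs \<partial>brw_iter a p k xs0) =
      ennreal (((\<lambda>s. measure_pmf.expectation p (\<lambda>N. s ^ N)) ^^ k) s ^ length xs0)"
    and "((\<lambda>s. measure_pmf.expectation p (\<lambda>N. s ^ N)) ^^ k) s \<in> {0..1}"
proof -
  define f :: "real \<Rightarrow> real" where "f s = measure_pmf.expectation p (\<lambda>N. s ^ N)" for s
  have "((\<lambda>s. \<integral>\<^sup>+b. s ^ b \<partial>p) ^^ k) (ennreal s) = ennreal ((f ^^ k) s) \<and> 0 \<le> (f ^^ k) s \<and> (f ^^ k) s \<le> 1"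
  proof (induction k)
    case (Suc k)
    let ?u = "(f ^^ k) s"
    have u: "0 \<le> ?u" "?u \<le> 1" using Suc by auto
    have "f ?u \<le> measure_pmf.expectation p (\<lambda>_. 1)" unfolding f_def[of ?u]
      using u by (intro integral_mono measure_pmf.integrable_const_bound[where B = 1]) (auto simp: power_le_one)
    moreover have "0 \<le> f ?u" unfolding f_def[of ?u] using u by (intro integral_nonneg_AE) auto
    ultimately show ?case using Suc nn_integral_power_pmf[OF u, of p] by (simp add: f_def[of ?u])
  qed (use assms in simp)
  then show "(\<integral>\<^sup>+xs. ennreal s ^ length xs \<partial>brw_iter a p k xs0) =
      ennreal (((\<lambda>s. measure_pmf.expectation p (\<lambda>N. s ^ N)) ^^ k) s ^ length xs0)"
    and "((\<lambda>s. measure_pmf.expectation p (\<lambda>N. s ^ N)) ^^ k) s \<in> {0..1}"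
    unfolding nn_integral_brw_iter_power f_def[abs_def] by (auto simp: ennreal_power)
qed

text \<open>\<open>0 ^ length xs\<close> is the indicator of the empty list, since
  \<open>0 ^ 0 = 1\<close>.\<close>

lemma emeasure_extinct:
  "emeasure (reproduction_space a p) {\<omega>. particles n \<omega> k = []} =
     ennreal (((\<lambda>s. measure_pmf.expectation p (\<lambda>N. s ^ N)) ^^ k) 0 ^ n)"
proof -
  have "emeasure (reproduction_space a p) {\<omega>. particles n \<omega> k = []} = (\<integral>\<^sup>+xs. ennreal 0 ^ length xs \<partial>brw_iter a p k (replicate n 0))"
    unfolding emeasure_particles[where P = "\<lambda>xs. xs = []"] by (intro nn_integral_cong) (auto simp: indicator_def)
  then show ?thesis by (subst (asm) nn_integral_power_length_brw_iter) simp_all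
qed

text \<open>Makes conditioning on survival meaningful, as \<open>cond_prob\<close> divides by this
  probability. The extinction events increase and their probabilities tend to
  \<open>e ^ n < 1\<close>.\<close>

lemma prob_survival_pos:
  fixes p :: "nat pmf"
  assumes mean: "1 < (\<integral>\<^sup>+N. of_nat N \<partial>p)" and n: "0 < n"
  shows "0 < measure (reproduction_space a p) {\<omega>. \<forall>k. particles n \<omega> k \<noteq> []}"
proof -
  interpret prob_space "reproduction_space a p" by (rule prob_space_reproduction_space)
  define f :: "real \<Rightarrow> real" where "f s = measure_pmf.expectation p (\<lambda>N. s ^ N)" for s
  obtain e where e: "0 \<le> e" "e < 1" "(\<lambda>k. (f ^^ k) 0) \<longlonglongrightarrow> e"
    using generating_function_iterates[OF mean] unfolding f_def[abs_def] by force
  let ?E = "\<lambda>k. {\<omega>. particles n \<omega> k = []}"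
  have meas: "measure (reproduction_space a p) (?E k) = (f ^^ k) 0 ^ n" for k
    using emeasure_extinct[of a p n k] nn_integral_power_length_brw_iter(2)[of 0 k p]
    by (simp add: measure_def f_def[abs_def])
  have "(\<lambda>k. measure (reproduction_space a p) (?E k)) \<longlonglongrightarrow> measure (reproduction_space a p) (\<Union>k. ?E k)"
    by (rule finite_Lim_measure_incseq)
       (auto simp: incseq_Suc_iff intro: sets_particles[where P = "\<lambda>xs. xs = []"])
  moreover have "(\<lambda>k. measure (reproduction_space a p) (?E k)) \<longlonglongrightarrow> e ^ n"
    unfolding meas by (intro tendsto_intros e)
  ultimately have "measure (reproduction_space a p) (\<Union>k. ?E k) = e ^ n" by (rule LIMSEQ_unique)
  moreover have "e ^ n < 1" using e n by (simp add: power_less_one_iff)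
  moreover have "(\<Union>k. ?E k) \<in> sets (reproduction_space a p)"
    by (intro sets.countable_UN) (auto intro: sets_particles[where P = "\<lambda>xs. xs = []"])
  moreover have "{\<omega>. \<forall>k. particles n \<omega> k \<noteq> []} = space (reproduction_space a p) - (\<Union>k. ?E k)" by auto
  ultimately show ?thesis by (simp add: prob_compl del: space_reproduction_space)
qed

text \<open>Surviving while the front fails from every restart time \<open>j\<close> is an event
  inside \<open>bad j - ext j\<close> for each \<open>j\<close>. Its probability is bounded by a
  difference of powers of two iterates with the same limit, hence is 0.\<close>

lemma survival_front:
  fixes L :: nat and V r :: int and s :: real and p :: "nat pmf"
  assumes L: "L > 0" and s01: "0 \<le> s" "s < 1"
    and s: "(\<integral>\<^sup>+ys. ennreal s ^ length (filter (\<lambda>z. V \<le> z) ys) \<partial>brw_iter a p L [0]) \<le> ennreal s"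
    and r: "\<And>j. j \<in> set_pmf a \<Longrightarrow> \<bar>j\<bar> \<le> r"
    and mean: "1 < (\<integral>\<^sup>+N. of_nat N \<partial>p)"
  shows "AE \<omega> in reproduction_space a p. (\<forall>k. particles n \<omega> k \<noteq> []) \<longrightarrow>
    (\<exists>j. \<forall>i. \<exists>z\<in>set (particles n \<omega> (j + i * L)). - r * int j + V * int i \<le> z)"
proof -
  let ?\<Omega> = "reproduction_space a p"
  interpret prob_space ?\<Omega> by (rule prob_space_reproduction_space)
  define f :: "real \<Rightarrow> real" where "f s = measure_pmf.expectation p (\<lambda>N. s ^ N)" for s
  obtain e where "\<And>s. 0 \<le> s \<Longrightarrow> s < 1 \<Longrightarrow> (\<lambda>k. (f ^^ k) s) \<longlonglongrightarrow> e"
    using generating_function_iterates[OF mean] unfolding f_def[abs_def] by force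
  then have lim: "(\<lambda>k. (f ^^ k) s) \<longlonglongrightarrow> e" "(\<lambda>k. (f ^^ k) 0) \<longlonglongrightarrow> e" using s01 by auto
  \<comment> \<open>An empty generation meets the condition vacuously, so extinction by generation
    \<open>j\<close> is part of \<open>bad j\<close> (take \<open>i = 0\<close>) and the two
    measures can be subtracted.\<close>
  define bad where "bad j = {\<omega>. \<exists>i. \<forall>z\<in>set (particles n \<omega> (j + i * L)). z < - r * int j + V * int i}" for j
  define ext where "ext j = {\<omega>. particles n \<omega> j = []}" for j
  have far_sets: "{\<omega>. \<forall>z\<in>set (particles n \<omega> (j + i * L)). z < - r * int j + V * int i} \<in> sets ?\<Omega>" for i j
    by (rule sets_particles[where P = "\<lambda>xs. \<forall>z\<in>set xs. z < - r * int j + V * int i"])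
  have bad_sets [measurable]: "bad j \<in> sets ?\<Omega>" for j
  proof -
    have "bad j = (\<Union>i. {\<omega>. \<forall>z\<in>set (particles n \<omega> (j + i * L)). z < - r * int j + V * int i})"
      by (auto simp: bad_def)
    also have "\<dots> \<in> sets ?\<Omega>" using far_sets by (intro sets.countable_UN) blast
    finally show ?thesis .
  qed
  have ext_sets [measurable]: "ext j \<in> sets ?\<Omega>" for j
    unfolding ext_def by (rule sets_particles[where P = "\<lambda>xs. xs = []"])
  have ext_bad: "ext j \<subseteq> bad j" for j
    unfolding ext_def bad_def by (auto intro!: exI[of _ 0])
  have bad_le: "emeasure ?\<Omega> (bad j) \<le> ennreal ((f ^^ j) s ^ n)" for j
  proof -
    \<comment> \<open>\<open>hit_prob\<close> has a finite horizon, so the bound is shown for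
      \<open>K\<close> blocks, uniformly in \<open>K\<close>, and passed to the increasing
      union.\<close>
    let ?A = "\<lambda>K. {\<omega>. \<exists>i\<le>K. \<forall>z\<in>set (particles n \<omega> (j + i * L)). z < - r * int j + V * int i}"
    define B where "B k xs \<longleftrightarrow> j \<le> k \<and> L dvd (k - j) \<and> (\<forall>z\<in>set xs. z < - r * int j + V * int ((k - j) div L))"
      for k and xs :: "int list"
    have A: "?A K \<in> sets ?\<Omega>" for K
    proof -
      have "?A K = (\<Union>i\<in>{..K}. {\<omega>. \<forall>z\<in>set (particles n \<omega> (j + i * L)). z < - r * int j + V * int i})" by auto
      also have "\<dots> \<in> sets ?\<Omega>" using far_sets by (intro sets.finite_UN) blast+
      finally show ?thesis .
    qed
    have "emeasure ?\<Omega> (?A K) \<le> ennreal ((f ^^ j) s ^ n)" for K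
    proof -
      let ?H = "{h. \<exists>k\<le>j + K * L. B k (h ! k)}"
      let ?hist = "\<lambda>\<omega>. map (particles n \<omega>) [0..<Suc (j + K * L)]"
      have "?A K \<subseteq> ?hist -` ?H \<inter> space ?\<Omega>"
      proof
        fix \<omega> assume "\<omega> \<in> ?A K"
        then obtain i where i: "i \<le> K" "\<forall>z\<in>set (particles n \<omega> (j + i * L)). z < - r * int j + V * int i" by auto
        have "j + i * L \<le> j + K * L" using i by simp
        moreover have "?hist \<omega> ! k = particles n \<omega> k" if "k \<le> j + K * L" for k
          using that by (simp add: less_Suc_eq_le del: upt_Suc)
        moreover have "B (j + i * L) (particles n \<omega> (j + i * L))" using i L by (simp add: B_def)
        ultimately have "\<exists>k\<le>j + K * L. B k (?hist \<omega> ! k)" by metis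
        then show "\<omega> \<in> ?hist -` ?H \<inter> space ?\<Omega>" by simp
      qed
      then have "emeasure ?\<Omega> (?A K) \<le> emeasure ?\<Omega> (?hist -` ?H \<inter> space ?\<Omega>)"
        by (intro emeasure_mono measurable_sets[OF measurable_history]) auto
      also have "\<dots> = emeasure (distr ?\<Omega> (count_space UNIV) ?hist) ?H"
        by (rule emeasure_distr[OF measurable_history, symmetric]) simp
      also have "\<dots> = hit_prob a p (j + K * L) B (replicate n 0)"
        unfolding distr_history by (rule emeasure_brw_path)
      also have "\<dots> \<le> (\<integral>\<^sup>+ys. ennreal s ^ length ys \<partial>brw_iter a p j (replicate n 0))"
        unfolding B_def[abs_def] using s01 by (intro hit_prob_shifted_block[OF L _ s r]) auto
      also have "\<dots> = ennreal ((f ^^ j) s ^ n)"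
        using s01 by (simp add: nn_integral_power_length_brw_iter f_def[abs_def])
      finally show ?thesis .
    qed
    then have "(SUP K. emeasure ?\<Omega> (?A K)) \<le> ennreal ((f ^^ j) s ^ n)" by (intro SUP_least)
    also have "(SUP K. emeasure ?\<Omega> (?A K)) = emeasure ?\<Omega> (\<Union>K. ?A K)"
    proof (rule SUP_emeasure_incseq)
      show "incseq ?A" by (auto simp: incseq_def intro: order_trans)
      show "range ?A \<subseteq> sets ?\<Omega>" using A by blast
    qed
    also have "(\<Union>K. ?A K) = bad j" by (auto simp: bad_def)
    finally show ?thesis .
  qed
  define S where "S = (\<Inter>j. bad j) - (\<Union>j. ext j)"
  have S_sets: "S \<in> sets ?\<Omega>" unfolding S_def by (intro sets.Diff sets.countable_INT sets.countable_UN) auto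
  have S_le: "measure ?\<Omega> S \<le> (f ^^ j) s ^ n - (f ^^ j) 0 ^ n" for j
  proof -
    have "measure ?\<Omega> S \<le> measure ?\<Omega> (bad j - ext j)"
      by (intro finite_measure_mono) (auto simp: S_def)
    also have "\<dots> = measure ?\<Omega> (bad j) - measure ?\<Omega> (ext j)"
      by (intro finite_measure_Diff ext_bad) auto
    also have "measure ?\<Omega> (ext j) = (f ^^ j) 0 ^ n"
      using emeasure_extinct[of a p n j] nn_integral_power_length_brw_iter(2)[of 0 j p]
      by (simp add: measure_def f_def[abs_def] ext_def)
    also have "measure ?\<Omega> (bad j) \<le> (f ^^ j) s ^ n"
      using bad_le[of j] nn_integral_power_length_brw_iter(2)[of s j p] s01
      by (simp add: emeasure_eq_measure f_def[abs_def])
    finally show ?thesis by simp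
  qed
  have "(\<lambda>j. (f ^^ j) s ^ n - (f ^^ j) 0 ^ n) \<longlonglongrightarrow> e ^ n - e ^ n"
    by (intro tendsto_intros lim)
  then have "measure ?\<Omega> S \<le> 0"
    using LIMSEQ_le_const[of _ _ "measure ?\<Omega> S"] S_le by fastforce
  then have "S \<in> null_sets ?\<Omega>"
    using S_sets measure_nonneg[of ?\<Omega> S] by (auto simp: null_sets_def emeasure_eq_measure)
  then have "AE \<omega> in ?\<Omega>. \<omega> \<notin> S" by (rule AE_not_in)
  then show ?thesis
    by eventually_elim (auto simp: S_def bad_def ext_def not_less)
qed

text \<open>Front particles are known only at block ends. Inside a block, a front particle at the
  next block end is traced back to its ancestor, at a cost of at most \<open>r * L\<close>; tracing
  forward would not do, since a line of descent may die out. As \<open>w * \<gamma> > 1\<close>, the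
  linear gain outgrows all constants.\<close>

lemma eventually_particles_beyond:
  fixes L :: nat and V r :: int and w \<gamma> :: real
  assumes steps: "\<And>k y. y \<in> set (particles n \<omega> (Suc k)) \<Longrightarrow> \<exists>x\<in>set (particles n \<omega> k). \<bar>y - x\<bar> \<le> r"
    and front: "\<And>i. \<exists>z\<in>set (particles n \<omega> (j + i * L)). - r * int j + V * int i \<le> z"
    and L: "0 < L" and w: "0 < w" "1 < w * \<gamma>" and V: "w * real L \<le> sqrt (real n) * real_of_int V"
    and n: "0 < n" and \<gamma>: "0 < \<gamma>" and r: "0 \<le> r"
  shows "\<forall>\<^sub>F t in at_top. total_on_set (particle_counts n \<omega> (nat \<lfloor>real n * \<gamma> * t\<rfloor>)) {sqrt (real n) * t<..} > 0"
proof -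
  let ?q = "sqrt (real n)"
  have q: "?q > 0" "?q * ?q = real n" using n by auto
  have ancestor: "\<exists>x\<in>set (particles n \<omega> k). \<bar>y - x\<bar> \<le> r * int d" if "y \<in> set (particles n \<omega> (k + d))" for k d y
    using that
  proof (induction d arbitrary: y)
    case (Suc d)
    obtain z where z: "z \<in> set (particles n \<omega> (k + d))" "\<bar>y - z\<bar> \<le> r"
      using steps[of y "k + d"] Suc.prems by (auto simp del: particles.simps)
    obtain x where x: "x \<in> set (particles n \<omega> k)" "\<bar>z - x\<bar> \<le> r * int d" using Suc.IH[OF z(1)] by blast
    then have "\<bar>y - x\<bar> \<le> r * int (Suc d)" using z(2) by (simp add: algebra_simps)
    with x(1) show ?case by blast
  qed auto
  have V0: "w * real L / ?q \<le> real_of_int V" using V q by (simp add: field_simps)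
  then have V_pos: "0 < real_of_int V" using L w q by (smt (verit) divide_pos_pos mult_pos_pos of_nat_0_less_iff)
  \<comment> \<open>Collects the losses: the generations before \<open>j\<close>, the drop by
    \<open>r * j\<close> at the restart, and the backward trace over at most \<open>L\<close>
    generations.\<close>
  define C where "C = w / ?q * real j + real_of_int r * real j + real_of_int r * real L"
  have far: "\<exists>x\<in>set (particles n \<omega> g). w / ?q * real g - C \<le> real_of_int x" if "j \<le> g" for g
  proof -
    obtain q m where qm: "g = j + q * L + m" "m < L"
      using \<open>j \<le> g\<close> L by (intro that[of "(g - j) div L" "(g - j) mod L"]) simp_all
    \<comment> \<open>Index of the first block end after \<open>g\<close>, reached in
      \<open>d\<close> further generations.\<close>
    define i where "i = q + 1"
    define d where "d = L - m"
    have iL: "j + i * L = g + d" "d \<le> L" "g - j \<le> i * L"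
      using qm by (auto simp: d_def i_def algebra_simps)
    obtain z where z: "z \<in> set (particles n \<omega> (g + d))" "- r * int j + V * int i \<le> z"
      using front[of i] iL by auto
    obtain x where x: "x \<in> set (particles n \<omega> g)" "\<bar>z - x\<bar> \<le> r * int d" using ancestor[OF z(1)] by blast
    have "r * int d \<le> r * int L" using iL r by (intro mult_left_mono) auto
    then have "V * int i - r * int j - r * int L \<le> x" using x z by linarith
    then have "real_of_int (V * int i - r * int j - r * int L) \<le> real_of_int x" by (rule of_int_le_iff[THEN iffD2])
    then have "real_of_int V * real i - real_of_int r * real j - real_of_int r * real L \<le> real_of_int x" by simp
    moreover have "w / ?q * (real g - real j) \<le> real_of_int V * real i"
    proof -
      have "real g - real j \<le> real i * real L"
        using iL(3) that by (simp flip: of_nat_mult of_nat_diff)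
      then have "w / ?q * (real g - real j) \<le> w / ?q * (real i * real L)"
        using w q by (intro mult_left_mono) auto
      also have "\<dots> = (w * real L / ?q) * real i" by simp
      also have "\<dots> \<le> real_of_int V * real i" using V0 by (intro mult_right_mono) auto
      finally show ?thesis .
    qed
    ultimately have "w / ?q * real g - C \<le> real_of_int x" unfolding C_def right_diff_distrib by linarith
    with x(1) show ?thesis by blast
  qed
  have "filterlim (\<lambda>t. real n * \<gamma> * t) at_top at_top" using n \<gamma> by real_asymp
  then have ev1: "\<forall>\<^sub>F t in at_top. real j + 1 \<le> real n * \<gamma> * t" by (simp add: filterlim_at_top)
  have "filterlim (\<lambda>t. (w * \<gamma> - 1) * ?q * t) at_top at_top" using w q by real_asymp
  \<comment> \<open>The term \<open>w / ?q\<close> pays for the floor in the generation index, and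
    the summand 1 yields a strict inequality.\<close>
  then have ev2: "\<forall>\<^sub>F t in at_top. w / ?q + C + 1 \<le> (w * \<gamma> - 1) * ?q * t" by (simp add: filterlim_at_top)
  from ev1 ev2 show ?thesis
  proof eventually_elim
    case (elim t)
    define g where "g = nat \<lfloor>real n * \<gamma> * t\<rfloor>"
    have g: "j \<le> g" "real n * \<gamma> * t - 1 \<le> real g" using elim(1) unfolding g_def by linarith+
    obtain x where x: "x \<in> set (particles n \<omega> g)" "w / ?q * real g - C \<le> real_of_int x"
      using far[OF g(1)] by blast
    have "w / ?q * (real n * \<gamma> * t - 1) \<le> w / ?q * real g" using g w q by (intro mult_left_mono) auto
    moreover have "w / ?q * (real n * \<gamma> * t - 1) = w * \<gamma> * ?q * t - w / ?q"
    proof -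
      have "w / ?q * (real n * \<gamma> * t - 1) = w * \<gamma> * (real n / ?q) * t - w / ?q"
        by (simp add: right_diff_distrib)
      then show ?thesis by (simp add: real_div_sqrt)
    qed
    moreover have "(w * \<gamma> - 1) * ?q * t = w * \<gamma> * ?q * t - ?q * t" by (simp add: left_diff_distrib)
    ultimately have "?q * t < real_of_int x"
      using x(2) elim(2) by linarith
    moreover have "particle_counts n \<omega> g x \<noteq> 0" using x(1) by (simp add: particle_counts_def count_list_0_iff)
    ultimately have "total_on_set (particle_counts n \<omega> g) {?q * t<..} \<noteq> 0"
      unfolding total_on_set_eq_0_iff by auto
    then show ?case unfolding g_def by (simp add: zero_less_iff_neq_zero)
  qed
qed

section \<open>Measurability and conclusion\<close>

text \<open>The event depends on \<open>t\<close> only through two integers, which makes the quantifier over \<open>t\<close> countable.\<close>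
lemma sets_eventually_floor:
  fixes c d :: real
  assumes "\<And>m l. {X \<in> space M. Q m l X} \<in> sets M"
  shows "{X \<in> space M. \<forall>\<^sub>F t in at_top. Q (nat \<lfloor>c * t\<rfloor>) \<lfloor>d * t\<rfloor> X} \<in> sets M"
proof -
  define I where "I T = {(nat \<lfloor>c * t\<rfloor>, \<lfloor>d * t\<rfloor>) |t. real T \<le> t}" for T :: nat
  have "(\<forall>\<^sub>F t in at_top. Q (nat \<lfloor>c * t\<rfloor>) \<lfloor>d * t\<rfloor> X) \<longleftrightarrow> (\<exists>T. \<forall>ml\<in>I T. Q (fst ml) (snd ml) X)" for X
    unfolding eventually_at_top_linorder
  proof
    assume "\<exists>N. \<forall>t\<ge>N. Q (nat \<lfloor>c * t\<rfloor>) \<lfloor>d * t\<rfloor> X"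
    then obtain N where N: "\<And>t. N \<le> t \<Longrightarrow> Q (nat \<lfloor>c * t\<rfloor>) \<lfloor>d * t\<rfloor> X" by blast
    obtain T :: nat where "N \<le> real T" using real_arch_simple by blast
    then show "\<exists>T. \<forall>ml\<in>I T. Q (fst ml) (snd ml) X" using N by (intro exI[of _ T]) (auto simp: I_def)
  next
    assume "\<exists>T. \<forall>ml\<in>I T. Q (fst ml) (snd ml) X"
    then show "\<exists>N. \<forall>t\<ge>N. Q (nat \<lfloor>c * t\<rfloor>) \<lfloor>d * t\<rfloor> X" unfolding I_def by fastforce
  qed
  moreover have "{X \<in> space M. \<exists>T. \<forall>ml\<in>I T. Q (fst ml) (snd ml) X} \<in> sets M"
    using assms by (intro sets.sets_Collect_countable_Ex sets.sets_Collect_countable_Ball) auto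
  ultimately show ?thesis by simp
qed

lemma total_on_set_greaterThan_eq_0_iff:
  "total_on_set f {y<..} = 0 \<longleftrightarrow> (\<forall>x. \<lfloor>y\<rfloor> < x \<longrightarrow> f x = 0)"
  by (simp add: total_on_set_eq_0_iff floor_less_iff)

lemma sets_path_space_coordinate:
  "{X \<in> space path_space. P (X k x)} \<in> sets path_space"
proof -
  have "(\<lambda>X. X k x) \<in> path_space \<rightarrow>\<^sub>M count_space UNIV"
    unfolding path_space_def
    by (rule measurable_compose[where g = "\<lambda>Y. Y x"]) (rule measurable_component_singleton, rule UNIV_I)+
  from measurable_sets[OF this, of "{v. P v}"] show ?thesis
    by (simp add: vimage_def Int_def conj_commute)
qed

lemma sets_eventually_occupation:
  "{X \<in> space path_space. \<forall>\<^sub>F t in at_top. total_on_set (occupation X (nat \<lfloor>c * t\<rfloor>)) {d * t<..} = 0} \<in> sets path_space"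
proof -
  \<comment> \<open>The bound \<open>k \<le> m\<close> is spelled out as an implication with a
    constant premise, so that only countable quantifiers and coordinate events remain.\<close>
  define Q where "Q m l X \<longleftrightarrow> (\<forall>x. l < x \<longrightarrow> (\<forall>k. k \<in> {..m} \<longrightarrow> X k x = 0))" for m :: nat and l and X :: "nat \<Rightarrow> int \<Rightarrow> nat"
  have "{X \<in> space path_space. Q m l X} \<in> sets path_space" for m l
    unfolding Q_def
    by (rule sets.sets_Collect_countable_All, rule sets.sets_Collect_imp,
        rule sets.sets_Collect_countable_All, rule sets.sets_Collect_imp,
        rule sets_path_space_coordinate, rule sets.sets_Collect_const, rule sets.sets_Collect_const)
  from sets_eventually_floor[of path_space Q, OF this] show ?thesis
    by (simp add: Q_def total_on_set_greaterThan_eq_0_iff occupation_def Ball_def)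
qed

lemma sets_eventually_total:
  "{X \<in> space path_space. \<forall>\<^sub>F t in at_top. total_on_set (X (nat \<lfloor>c * t\<rfloor>)) {d * t<..} > 0} \<in> sets path_space"
proof -
  define Q where "Q m l X \<longleftrightarrow> \<not> (\<forall>x. l < x \<longrightarrow> X m x = 0)" for m :: nat and l and X :: "nat \<Rightarrow> int \<Rightarrow> nat"
  have "{X \<in> space path_space. Q m l X} \<in> sets path_space" for m l
    unfolding Q_def
    by (rule sets.sets_Collect_neg, rule sets.sets_Collect_countable_All, rule sets.sets_Collect_imp,
        rule sets_path_space_coordinate, rule sets.sets_Collect_const)
  from sets_eventually_floor[of path_space Q, OF this] show ?thesis
    unfolding Q_def zero_less_iff_neq_zero total_on_set_greaterThan_eq_0_iff .
qed

lemma sets_survives: "{X \<in> space path_space. survives X} \<in> sets path_space"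
  unfolding survives_def
  by (rule sets.sets_Collect_countable_All, rule sets.sets_Collect_countable_Ex, rule sets_path_space_coordinate)

lemma survives_particle_counts: "survives (particle_counts n \<omega>) \<longleftrightarrow> (\<forall>k. particles n \<omega> k \<noteq> [])"
proof -
  have "(\<exists>x. 0 < count_list xs x) \<longleftrightarrow> xs \<noteq> []" for xs :: "int list"
    by (cases xs) (auto intro: exI[of _ "hd xs"])
  then show ?thesis by (simp add: survives_def particle_counts_def)
qed

lemma space_brw_law [simp]: "space (brw_law a p n) = space path_space"
  and sets_brw_law [simp]: "sets (brw_law a p n) = sets path_space"
  by (simp_all add: brw_law_def)

lemma AE_brw_law_iff:
  assumes "{X \<in> space path_space. Q X} \<in> sets path_space"
  shows "(AE X in brw_law a p n. Q X) \<longleftrightarrow> (AE \<omega> in reproduction_space a p. Q (particle_counts n \<omega>))"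
  unfolding brw_law_def by (rule AE_distr_iff[OF measurable_particle_counts assms])

lemma jump_bound:
  assumes "\<And>k. k \<in> set_pmf a \<Longrightarrow> real_of_int k \<in> {-R..R}"
  shows "\<And>j. j \<in> set_pmf a \<Longrightarrow> \<bar>j\<bar> \<le> \<lceil>R\<rceil>" "0 \<le> \<lceil>R\<rceil>"
proof -
  show *: "\<bar>j\<bar> \<le> \<lceil>R\<rceil>" if "j \<in> set_pmf a" for j
    using assms[OF that] by (auto simp: abs_le_iff) linarith+
  obtain j where "j \<in> set_pmf a" using set_pmf_not_empty[of a] by blast
  from *[OF this] show "0 \<le> \<lceil>R\<rceil>" by linarith
qed

section \<open>The two probabilities for large n\<close>

lemma prob_no_particles_beyond:
  fixes a :: "int pmf" and p :: "nat \<Rightarrow> nat pmf" and \<theta> \<gamma> :: real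
  assumes r: "\<And>j. j \<in> set_pmf a \<Longrightarrow> \<bar>j\<bar> \<le> r"
    and mean: "measure_pmf.expectation a real_of_int = 0"
    and var: "measure_pmf.variance a real_of_int > 0"
    and offspring: "\<And>n. 0 < n \<Longrightarrow> measure_pmf.expectation (p n) real = 1 + \<theta> / real n"
    and \<theta>: "0 < \<theta>" and \<gamma>: "0 < \<gamma>" "2 * \<theta> * measure_pmf.variance a real_of_int * \<gamma>\<^sup>2 < 1"
  shows "\<forall>\<^sub>F n in sequentially. \<P>(X in brw_law a (p n) n. \<forall>\<^sub>F t in at_top.
    total_on_set (occupation X (nat \<lfloor>real n * \<gamma> * t\<rfloor>)) {sqrt (real n) * t<..} = 0) = 1"
proof -
  obtain c where c: "c > 0" "\<forall>\<^sub>F n in sequentially. (1 + \<theta> / real n) *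
      measure_pmf.expectation a (\<lambda>j. exp (c / sqrt (real n) * real_of_int j)) * exp (- (c / sqrt (real n)) / (\<gamma> * sqrt (real n))) < 1"
    using subcritical_tilt[OF r mean var \<theta> \<gamma>] by blast
  from c(2) eventually_gt_at_top[of 0] show ?thesis
  proof eventually_elim
    case (elim n)
    interpret prob_space "brw_law a (p n) n" by (rule prob_space_brw_law)
    \<comment> \<open>A line of slope \<open>1 / (\<gamma> * sqrt n)\<close> per generation has
      height \<open>sqrt n * t\<close> at time \<open>n * \<gamma> * t\<close>.\<close>
    have "AE \<omega> in reproduction_space a (p n). \<forall>\<^sub>F k in sequentially.
        \<forall>x\<in>set (particles n \<omega> k). real_of_int x \<le> 1 / (\<gamma> * sqrt (real n)) * real k"
      using elim c(1) \<theta> by (intro subcritical_front[OF r offspring, where l = "c / sqrt (real n)"]) (auto simp: add_pos_pos)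
    then have "AE \<omega> in reproduction_space a (p n). \<forall>\<^sub>F t in at_top.
        total_on_set (occupation (particle_counts n \<omega>) (nat \<lfloor>real n * \<gamma> * t\<rfloor>)) {sqrt (real n) * t<..} = 0"
      by eventually_elim (rule eventually_no_particles_beyond[OF _ \<gamma>(1) elim(2)])
    then have "AE X in brw_law a (p n) n. \<forall>\<^sub>F t in at_top.
        total_on_set (occupation X (nat \<lfloor>real n * \<gamma> * t\<rfloor>)) {sqrt (real n) * t<..} = 0"
      by (subst AE_brw_law_iff[OF sets_eventually_occupation])
    then show ?case
      using prob_Collect_eq_1[of "\<lambda>X. \<forall>\<^sub>F t in at_top.
        total_on_set (occupation X (nat \<lfloor>real n * \<gamma> * t\<rfloor>)) {sqrt (real n) * t<..} = 0"]
        sets_eventually_occupation[of "real n * \<gamma>" "sqrt (real n)"] by simp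
  qed
qed

lemma prob_particles_beyond:
  fixes a :: "int pmf" and p :: "nat \<Rightarrow> nat pmf" and \<theta> \<gamma> :: real
  assumes r: "\<And>j. j \<in> set_pmf a \<Longrightarrow> \<bar>j\<bar> \<le> r" "0 \<le> r"
    and mean: "measure_pmf.expectation a real_of_int = 0"
    and var: "measure_pmf.variance a real_of_int > 0"
    and offspring: "\<And>n. 0 < n \<Longrightarrow> measure_pmf.expectation (p n) real = 1 + \<theta> / real n"
    and \<theta>: "0 < \<theta>" and \<gamma>: "0 < \<gamma>" "1 < 2 * \<theta> * measure_pmf.variance a real_of_int * \<gamma>\<^sup>2"
  shows "\<forall>\<^sub>F n in sequentially. \<P>(X in brw_law a (p n) n. (\<forall>\<^sub>F t in at_top.
    total_on_set (X (nat \<lfloor>real n * \<gamma> * t\<rfloor>)) {sqrt (real n) * t<..} > 0) \<bar> survives X) = 1"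
proof -
  let ?v = "measure_pmf.variance a real_of_int"
  have "1 / \<gamma> < sqrt (2 * \<theta> * ?v)"
    using \<gamma> by (intro real_less_rsqrt) (simp add: power_divide pos_divide_less_eq)
  \<comment> \<open>\<open>w\<close> is a speed in units of \<open>1 / sqrt n\<close> per
    generation: above \<open>1 / \<gamma>\<close>, which the conclusion demands, and below the
    critical speed, so that \<open>supercritical_block\<close> applies.\<close>
  then obtain w where w: "1 / \<gamma> < w" "w < sqrt (2 * \<theta> * ?v)" using dense by blast
  have w0: "0 < w" using w(1) \<gamma>(1) by (meson divide_pos_pos less_trans zero_less_one)
  have w\<gamma>: "1 < w * \<gamma>" using w(1) \<gamma>(1) by (simp add: pos_divide_less_eq)
  have "\<forall>\<^sub>F n in sequentially. \<exists>L V. 0 < L \<and> w * real L \<le> sqrt (real n) * real_of_int V \<and>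
      1 < (1 + \<theta> / real n) ^ L * measure (walk_pmf a L) {s. V \<le> s}"
    by (rule supercritical_block[OF r(1) mean var \<theta> w0 w(2)])
  then show ?thesis using eventually_gt_at_top[of 0]
  proof eventually_elim
    case (elim n)
    let ?p = "p n" and ?\<Omega> = "reproduction_space a (p n)" and ?M = "brw_law a (p n) n"
    define m where "m = 1 + \<theta> / real n"
    interpret prob_space ?M by (rule prob_space_brw_law)
    have m: "1 < m" using \<theta> elim(2) by (simp add: m_def)
    have mean_p: "(\<integral>\<^sup>+b. of_nat b \<partial>?p) = ennreal m"
      using m offspring[OF elim(2)] by (intro nn_integral_offspring_mean) (simp_all add: m_def)
    then have mean_gt: "1 < (\<integral>\<^sup>+b. of_nat b \<partial>?p)" using m by (metis ennreal_1 ennreal_less_iff zero_le_one)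
    obtain L V where LV: "0 < L" "w * real L \<le> sqrt (real n) * real_of_int V"
      "1 < m ^ L * measure (walk_pmf a L) {s. V \<le> s}" using elim(1) unfolding m_def by blast
    let ?N = "\<lambda>ys. length (filter (\<lambda>z. V \<le> z) ys)"
    \<comment> \<open>Many-to-one formula for the indicator of \<open>{V..}\<close>: the expected
      number of descendants displaced by at least \<open>V\<close> exceeds 1, so
      \<open>ex_generating_function_le\<close> supplies \<open>s\<close> for the block
      argument.\<close>
    have "(\<integral>\<^sup>+N. of_nat N \<partial>map_pmf ?N (brw_iter a ?p L [0])) =
        (\<integral>\<^sup>+ys. sum_list (map (indicator {V..}) ys) \<partial>brw_iter a ?p L [0])"
    proof -
      have "of_nat (?N ys) = (sum_list (map (indicator {V..}) ys) :: ennreal)" for ys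
        by (induction ys) (auto simp: indicator_def)
      then show ?thesis by simp
    qed
    also have "\<dots> = ennreal m ^ L * emeasure (walk_pmf a L) {V..}"
      unfolding nn_integral_brw_iter_sum_list funpow_walk_pmf by (simp add: mean_p)
    also have "\<dots> = ennreal (m ^ L * measure (walk_pmf a L) {s. V \<le> s})"
      using m by (simp add: ennreal_mult ennreal_power measure_pmf.emeasure_eq_measure atLeast_def)
    also have "\<dots> > 1" using LV(3) by (metis ennreal_1 ennreal_less_iff zero_le_one)
    finally obtain s where s: "0 < s" "s < 1" "(\<integral>\<^sup>+ys. ennreal s ^ ?N ys \<partial>brw_iter a ?p L [0]) \<le> ennreal s"
      using ex_generating_function_le[of "map_pmf ?N (brw_iter a ?p L [0])"] by auto
    let ?G = "\<lambda>X. \<forall>\<^sub>F t in at_top. total_on_set (X (nat \<lfloor>real n * \<gamma> * t\<rfloor>)) {sqrt (real n) * t<..} > 0"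
    have front: "AE \<omega> in ?\<Omega>. (\<forall>k. particles n \<omega> k \<noteq> []) \<longrightarrow>
        (\<exists>j. \<forall>i. \<exists>z\<in>set (particles n \<omega> (j + i * L)). - r * int j + V * int i \<le> z)"
      by (rule survival_front[OF LV(1) less_imp_le[OF s(1)] s(2,3) r(1) mean_gt])
    have steps: "AE \<omega> in ?\<Omega>. \<forall>k. \<forall>y\<in>set (particles n \<omega> (Suc k)). \<exists>x\<in>set (particles n \<omega> k). \<bar>y - x\<bar> \<le> r"
      by (rule AE_steps[OF r(1)])
    from front steps have "AE \<omega> in ?\<Omega>. survives (particle_counts n \<omega>) \<longrightarrow> ?G (particle_counts n \<omega>)"
    proof eventually_elim
      case (elim \<omega>)
      show ?case
      proof
        assume "survives (particle_counts n \<omega>)"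
        then obtain j where "\<And>i. \<exists>z\<in>set (particles n \<omega> (j + i * L)). - r * int j + V * int i \<le> z"
          using elim(1) by (auto simp: survives_particle_counts)
        then show "?G (particle_counts n \<omega>)"
          using elim(2) by (intro eventually_particles_beyond[OF _ _ LV(1) w0 w\<gamma> LV(2) \<open>0 < n\<close> \<gamma>(1) r(2)]) blast+
      qed
    qed
    then have AE: "AE X in ?M. survives X \<longrightarrow> ?G X"
      by (subst AE_brw_law_iff) (intro sets.sets_Collect_imp sets_survives sets_eventually_total)
    have "measure ?M {X \<in> space ?M. survives X} = measure ?\<Omega> {\<omega>. \<forall>k. particles n \<omega> k \<noteq> []}"
      unfolding brw_law_def by (subst measure_distr[OF measurable_particle_counts])
        (use measurable_space[OF measurable_particle_counts] sets_survives in
          \<open>auto simp: survives_particle_counts intro!: arg_cong2[where f = measure]\<close>)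
    then have pos: "0 < measure ?M {X \<in> space ?M. survives X}"
      using prob_survival_pos[OF mean_gt elim(2)] by simp
    \<comment> \<open>Up to a null set survival implies \<open>?G\<close>, so numerator and
      denominator of the conditional probability agree.\<close>
    have "measure ?M {X \<in> space ?M. ?G X \<and> survives X} = measure ?M {X \<in> space ?M. survives X}"
      using AE sets_survives sets_eventually_total[of "real n * \<gamma>" "sqrt (real n)"]
      by (intro finite_measure_eq_AE) (auto intro: sets.sets_Collect_conj elim: eventually_mono)
    then show ?case using pos by (simp add: cond_prob_def)
  qed
qed

theorem theorem1p7:
  fixes a :: "int pmf" and R :: real and F :: "real \<Rightarrow> nat pmf"
    and \<sigma> \<delta> \<theta> \<gamma>bar :: real
  assumes jump_bounded: "\<And>k. k \<in> set_pmf a \<Longrightarrow> real_of_int k \<in> {-R..R}"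
    and jump_mean: "measure_pmf.expectation a real_of_int = 0"
    and jump_variance: "measure_pmf.variance a real_of_int > 0"
    and offspring_0: "\<And>\<eta>. \<eta> > -1 \<Longrightarrow> pmf (F \<eta>) 0 > 0"
    and offspring_mean: "\<And>\<eta>. \<eta> > -1 \<Longrightarrow> measure_pmf.expectation (F \<eta>) real = 1 + \<eta>"
    and \<sigma>_pos: "\<sigma> > 0"
    and \<delta>_pos: "\<delta> > 0"
    and offspring_sd:
      "((\<lambda>\<eta>. sqrt (measure_pmf.variance (F \<eta>) real)) \<longlongrightarrow> \<sigma>) (at_right 0)"
    and offspring_third_moment:
      "(SUP \<eta>\<in>{0<..<\<delta>}. \<integral>\<^sup>+ i. ennreal (real i ^ 3) \<partial>measure_pmf (F \<eta>)) < \<infinity>"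
    and \<theta>_pos: "\<theta> > 0"
    and \<gamma>bar: "\<gamma>bar = (2 * \<theta> * measure_pmf.variance a real_of_int) powr (-1/2)"
  shows "(\<forall>\<gamma>. 0 < \<gamma> \<and> \<gamma> < \<gamma>bar \<longrightarrow>
           (\<exists>N::nat. N > 0 \<and> (\<forall>n>N.
              \<P>(X in brw_law a (F (\<theta> / real n)) n.
                \<forall>\<^sub>F t in at_top.
                  total_on_set (occupation X (nat \<lfloor>real n * \<gamma> * t\<rfloor>)) {sqrt (real n) * t<..} = 0) = 1)))
       \<and> (\<forall>\<gamma>. \<gamma> > \<gamma>bar \<longrightarrow>
           (\<exists>N::nat. N > 0 \<and> (\<forall>n>N.
              \<P>(X in brw_law a (F (\<theta> / real n)) n.
                (\<forall>\<^sub>F t in at_top.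
                  total_on_set (X (nat \<lfloor>real n * \<gamma> * t\<rfloor>)) {sqrt (real n) * t<..} > 0)
                \<bar> survives X) = 1)))"
proof -
  let ?b = "2 * \<theta> * measure_pmf.variance a real_of_int"
  have b: "0 < ?b" using \<theta>_pos jump_variance by simp
  have bar: "\<gamma>bar = 1 / sqrt ?b"
    unfolding \<gamma>bar using b by (simp add: powr_minus_divide powr_half_sqrt)
  note r = jump_bound[OF jump_bounded]
  have offspring: "measure_pmf.expectation (F (\<theta> / real n)) real = 1 + \<theta> / real n" if "0 < n" for n
    using \<theta>_pos that by (intro offspring_mean) (simp add: less_trans[of _ 0])
  have threshold: "\<exists>N::nat. N > 0 \<and> (\<forall>n>N. P n)" if "\<forall>\<^sub>F n in sequentially. P n" for P :: "nat \<Rightarrow> bool"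
    using that unfolding eventually_sequentially
    by (metis less_imp_le_nat max.strict_boundedE max_less_iff_conj zero_less_Suc less_trans Suc_lessD)
  \<comment> \<open>Turns the comparison of \<gamma> with \<gamma>bar into that of
    \<open>?b * \<gamma>^2\<close> with 1, the form used in both regimes.\<close>
  have sq: "(\<gamma> * sqrt ?b)\<^sup>2 = ?b * \<gamma>\<^sup>2" for \<gamma> using b by (simp add: power_mult_distrib)
  show ?thesis
  proof (intro conjI allI impI)
    fix \<gamma> assume \<gamma>: "0 < \<gamma> \<and> \<gamma> < \<gamma>bar"
    then have "\<gamma> * sqrt ?b < 1" using b by (simp add: bar pos_less_divide_eq)
    then have "?b * \<gamma>\<^sup>2 < 1"
      unfolding sq[symmetric] using \<gamma> b by (intro power_less_one_iff[THEN iffD2]) auto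
    then show "\<exists>N::nat. N > 0 \<and> (\<forall>n>N. \<P>(X in brw_law a (F (\<theta> / real n)) n. \<forall>\<^sub>F t in at_top.
        total_on_set (occupation X (nat \<lfloor>real n * \<gamma> * t\<rfloor>)) {sqrt (real n) * t<..} = 0) = 1)"
      using \<gamma> by (intro threshold prob_no_particles_beyond[where p = "\<lambda>n. F (\<theta> / real n)", OF r(1) jump_mean jump_variance offspring \<theta>_pos]) auto
  next
    fix \<gamma> assume \<gamma>: "\<gamma>bar < \<gamma>"
    have "0 < \<gamma>bar" unfolding bar using b by (intro divide_pos_pos) auto
    with \<gamma> have \<gamma>0: "0 < \<gamma>" by (rule less_trans[rotated])
    have "1 < \<gamma> * sqrt ?b" using \<gamma> b by (simp add: bar pos_divide_less_eq)
    then have "1 < ?b * \<gamma>\<^sup>2"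
      unfolding sq[symmetric] by (intro one_less_power) auto
    then show "\<exists>N::nat. N > 0 \<and> (\<forall>n>N. \<P>(X in brw_law a (F (\<theta> / real n)) n. (\<forall>\<^sub>F t in at_top.
        total_on_set (X (nat \<lfloor>real n * \<gamma> * t\<rfloor>)) {sqrt (real n) * t<..} > 0) \<bar> survives X) = 1)"
      using \<gamma>0 by (intro threshold prob_particles_beyond[where p = "\<lambda>n. F (\<theta> / real n)", OF r jump_mean jump_variance offspring \<theta>_pos]) auto
  qed
qed

end
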